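(* Let $n\ge1$, $k\ge3$, $\alpha\ge 0$, and let $f:S_k^n\to[k]$ be a social choice function with $\mathbf{D}(f,\overline{\mathrm{NONMANIP}})\le\alpha$. Then either $$\mathbf{D}(f,\mathrm{NONMANIP})<100\,n^4k^8\alpha^{1/3},$$ or, for $\sigma\in S_k^n$ uniformly random, $$\mathbb{P}(\sigma\in M(f))\ge\mathbb{P}(\sigma\in M_3(f))\ge\alpha.$$
   Context: $[k]=\{1,\dots,k\}$, $S_k$ is the set of total orderings of $[k]$, and a social choice function (SCF) is a map $f:S_k^n\to[k]$; $\sigma=(\sigma_1,\dots,\sigma_n)\in S_k^n$ is a ranking profile. Write $a\overset{\sigma_i}{>}b$ if $\sigma_i$ ranks $a$ above $b$. $\sigma$ is a manipulation point of $f$ if there are $i$ and $\sigma'$ differing from $\sigma$ only in coordinate $i$ with $f(\sigma')\overset{\sigma_i}{>}f(\sigma)$; it is an $r$-manipulation point if such $\sigma'$ exists with $\sigma'_i$ obtained from $\sigma_i$ by permuting at most $r$ alternatives in adjacent positions of $\sigma_i$. $M(f)$, $M_r(f)$ denote these sets. For nonempty $H\subseteq[k]$, $\mathrm{top}_H$ maps a ranking to its highest-ranked element of $H$. A SCF taking exactly two values $a,b$ is monotone if whenever $\sigma,\sigma'$ differ only in coordinate $i$ with $f(\sigma)=a$, $f(\sigma')=b$, then $a\overset{\sigma_i}{>}b$ and $b\overset{\sigma'_i}{>}a$. $\mathrm{NONMANIP}$ is the set of SCFs which either equal $\sigma\mapsto\mathrm{top}_H(\sigma_i)$ for some $i$ and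 nonempty $H$, or are monotone and take exactly two values. $\overline{\mathrm{NONMANIP}}$ is the set of SCFs $f:S_k^n\to[k]$ that depend on only one coordinate or take at most two values. $\mathbf{D}(f,g)=\mathbb{P}(f(\sigma)\ne g(\sigma))$ for uniform $\sigma\in S_k^n$, and $\mathbf{D}(f,G)=\min_{g\in G}\mathbf{D}(f,g)$. *)

theory Defs
  imports "HOL-Probability.Probability" "HOL-Combinatorics.Permutations"
begin

text \<open>
  A ranking \<open>R\<close> of the alternatives \<open>{1..k}\<close> is a (reflexive) linear order in which
  \<open>(a, b) \<in> R\<close> means that \<open>b\<close> is ranked at least as high as \<open>a\<close>.
\<close>

definition rankings :: "nat \<Rightarrow> nat rel set" where
  "rankings k = {R. linear_order_on {1..k} R}"

definition prefers :: "nat rel \<Rightarrow> nat \<Rightarrow> nat \<Rightarrow> bool" where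
  "prefers R a b \<longleftrightarrow> a \<noteq> b \<and> (b, a) \<in> R"

definition top_of :: "nat set \<Rightarrow> nat rel \<Rightarrow> nat" where
  "top_of H R = (THE a. a \<in> H \<and> (\<forall>b\<in>H. (b, a) \<in> R))"

text \<open>Positions are counted from the top, the highest-ranked alternative having position 1.\<close>

definition position :: "nat rel \<Rightarrow> nat \<Rightarrow> nat" where
  "position R a = card {b. (a, b) \<in> R}"

text \<open>
  A set \<open>B\<close> of at most \<open>r\<close> alternatives occupying adjacent positions of \<open>R\<close> is permuted by \<open>\<pi>\<close>;
  the relabelled order \<open>R'\<close> has \<open>\<pi> a\<close> at the position where \<open>R\<close> has \<open>a\<close>.
\<close>

definition adjacent_permutation :: "nat \<Rightarrow> nat \<Rightarrow> nat rel \<Rightarrow> nat rel \<Rightarrow> bool" where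
  "adjacent_permutation k r R R' \<longleftrightarrow>
     (\<exists>B \<pi>. B \<subseteq> {1..k} \<and> card B \<le> r \<and> (\<exists>p q. position R ` B = {p..q}) \<and>
            \<pi> permutes B \<and> R' = map_prod \<pi> \<pi> ` R)"

definition profiles :: "nat \<Rightarrow> nat \<Rightarrow> (nat \<Rightarrow> nat rel) set" where
  "profiles n k = {1..n} \<rightarrow>\<^sub>E rankings k"

definition SCF :: "nat \<Rightarrow> nat \<Rightarrow> ((nat \<Rightarrow> nat rel) \<Rightarrow> nat) set" where
  "SCF n k = profiles n k \<rightarrow>\<^sub>E {1..k}"

definition differ_only_at :: "nat \<Rightarrow> nat \<Rightarrow> (nat \<Rightarrow> nat rel) \<Rightarrow> (nat \<Rightarrow> nat rel) \<Rightarrow> bool" where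
  "differ_only_at n i \<sigma> \<sigma>' \<longleftrightarrow> (\<forall>j\<in>{1..n} - {i}. \<sigma>' j = \<sigma> j)"

definition manipulation_points ::
  "nat \<Rightarrow> nat \<Rightarrow> ((nat \<Rightarrow> nat rel) \<Rightarrow> nat) \<Rightarrow> (nat \<Rightarrow> nat rel) set" where
  "manipulation_points n k f =
     {\<sigma> \<in> profiles n k. \<exists>i\<in>{1..n}. \<exists>\<sigma>'\<in>profiles n k.
        differ_only_at n i \<sigma> \<sigma>' \<and> prefers (\<sigma> i) (f \<sigma>') (f \<sigma>)}"

definition r_manipulation_points ::
  "nat \<Rightarrow> nat \<Rightarrow> nat \<Rightarrow> ((nat \<Rightarrow> nat rel) \<Rightarrow> nat) \<Rightarrow> (nat \<Rightarrow> nat rel) set" where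
  "r_manipulation_points r n k f =
     {\<sigma> \<in> profiles n k. \<exists>i\<in>{1..n}. \<exists>\<sigma>'\<in>profiles n k.
        differ_only_at n i \<sigma> \<sigma>' \<and> prefers (\<sigma> i) (f \<sigma>') (f \<sigma>) \<and>
        adjacent_permutation k r (\<sigma> i) (\<sigma>' i)}"

definition monotone_two_valued :: "nat \<Rightarrow> nat \<Rightarrow> ((nat \<Rightarrow> nat rel) \<Rightarrow> nat) \<Rightarrow> bool" where
  "monotone_two_valued n k f \<longleftrightarrow>
     (\<exists>a b. a \<noteq> b \<and> f ` profiles n k = {a, b} \<and>
        (\<forall>i\<in>{1..n}. \<forall>\<sigma>\<in>profiles n k. \<forall>\<sigma>'\<in>profiles n k.
           differ_only_at n i \<sigma> \<sigma>' \<longrightarrow> f \<sigma> = a \<longrightarrow> f \<sigma>' = b \<longrightarrow>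
           prefers (\<sigma> i) a b \<and> prefers (\<sigma>' i) b a))"

definition NONMANIP :: "nat \<Rightarrow> nat \<Rightarrow> ((nat \<Rightarrow> nat rel) \<Rightarrow> nat) set" where
  "NONMANIP n k =
     {f \<in> SCF n k.
        (\<exists>i\<in>{1..n}. \<exists>H. H \<noteq> {} \<and> H \<subseteq> {1..k} \<and> (\<forall>\<sigma>\<in>profiles n k. f \<sigma> = top_of H (\<sigma> i))) \<or>
        monotone_two_valued n k f}"

definition NONMANIP_bar :: "nat \<Rightarrow> nat \<Rightarrow> ((nat \<Rightarrow> nat rel) \<Rightarrow> nat) set" where
  "NONMANIP_bar n k =
     {f \<in> SCF n k.
        (\<exists>i\<in>{1..n}. \<forall>\<sigma>\<in>profiles n k. \<forall>\<sigma>'\<in>profiles n k. \<sigma> i = \<sigma>' i \<longrightarrow> f \<sigma> = f \<sigma>') \<or>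
        card (f ` profiles n k) \<le> 2}"

definition prob_profile :: "nat \<Rightarrow> nat \<Rightarrow> (nat \<Rightarrow> nat rel) set \<Rightarrow> real" where
  "prob_profile n k A = measure_pmf.prob (pmf_of_set (profiles n k)) A"

definition distance ::
  "nat \<Rightarrow> nat \<Rightarrow> ((nat \<Rightarrow> nat rel) \<Rightarrow> nat) \<Rightarrow> ((nat \<Rightarrow> nat rel) \<Rightarrow> nat) \<Rightarrow> real" where
  "distance n k f g = prob_profile n k {\<sigma>. f \<sigma> \<noteq> g \<sigma>}"

definition distance_to_set ::
  "nat \<Rightarrow> nat \<Rightarrow> ((nat \<Rightarrow> nat rel) \<Rightarrow> nat) \<Rightarrow> ((nat \<Rightarrow> nat rel) \<Rightarrow> nat) set \<Rightarrow> real" where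
  "distance_to_set n k f G = Min (distance n k f ` G)"

end

theory Submission
  imports Defs
begin

text \<open>
  Swapping two neighbouring alternatives in one ranking of a profile can change the outcome of
  \<open>f\<close> without creating a manipulation only if the outcome moves from the upper to the lower of
  the two swapped alternatives. Such swaps generate all permutations of positions by short words,
  so by the union bound any property of the outcome that is insensitive to the swaps in question
  is nearly constant along them. All losses are linear in \<open>\<alpha>\<close> and polynomial in \<open>n\<close> and \<open>k\<close>.

  If \<open>f\<close> is close to a function of voter \<open>i\<close>, an averaging argument reduces to a single voter.
  For each alternative \<open>b\<close>, moving \<open>b\<close> to the top neither stops \<open>b\<close> from being elected nor changes
  the outcome if \<open>b\<close> is above it, and among rankings with \<open>b\<close> on top the event that \<open>b\<close> is elected
  is nearly constant. Hence either \<open>b\<close> is rarely elected or \<open>b\<close> is rarely above the winner; the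
  alternatives of the second kind form \<open>H\<close>.

  If \<open>f\<close> is close to a function with values \<open>a\<close> and \<open>b\<close>, swaps that do not exchange \<open>a\<close> and \<open>b\<close>
  show that \<open>f\<close> nearly depends only on the set of voters preferring \<open>a\<close> to \<open>b\<close>, and exchanging
  adjacent \<open>a\<close> and \<open>b\<close> shows that few edges of this cube violate monotonicity; compressing
  along each coordinate in turn repairs them.
\<close>

subsection \<open>Adjacent transpositions\<close>

abbreviation swap :: "'a \<Rightarrow> 'a \<Rightarrow> 'a \<Rightarrow> 'a" where
  "swap \<equiv> Transposition.transpose"

abbreviation adj_swap :: "nat \<Rightarrow> nat \<Rightarrow> nat" where
  "adj_swap j \<equiv> swap j (Suc j)"

lemma adj_swap_permutes: "l \<le> j \<Longrightarrow> j < k \<Longrightarrow> adj_swap j permutes {l..k}"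
  by (rule permutes_swap_id) auto

text \<open>Conjugating by a neighbour swap lengthens a transposition by one step, so each further
  unit of distance costs two swaps. \<open>D\<close> models the number of points at which an event
  changes under a permutation, which the union bound makes subadditive.\<close>

lemma transpose_le_adj_swaps:
  fixes D :: "(nat \<Rightarrow> nat) \<Rightarrow> nat"
  assumes sub: "\<And>v w. v permutes {l..k} \<Longrightarrow> w permutes {l..k} \<Longrightarrow> D (v \<circ> w) \<le> D v + D w"
    and adj: "\<And>j. l \<le> j \<Longrightarrow> j < k \<Longrightarrow> D (adj_swap j) \<le> N"
    and "l \<le> i" "Suc (i + d) \<le> k"
  shows "D (swap i (Suc (i + d))) \<le> (2 * d + 1) * N"
  using assms(4)
proof (induction d)
  case 0
  then show ?case using adj[of i] assms(3) by simp
next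
  case (Suc d)
  let ?m = "Suc (i + d)"
  have e: "swap i (Suc ?m) = adj_swap ?m \<circ> (swap i ?m \<circ> adj_swap ?m)"
    by (auto simp: fun_eq_iff Transposition.transpose_def)
  have p: "adj_swap ?m permutes {l..k}" "swap i ?m permutes {l..k}"
    using Suc.prems assms(3) by (auto intro!: permutes_swap_id)
  have "D (swap i (Suc ?m)) \<le> D (adj_swap ?m) + (D (swap i ?m) + D (adj_swap ?m))"
    unfolding e using sub[OF p(1) permutes_compose[OF p(1,2)]] sub[OF p(2,1)] by linarith
  also have "\<dots> \<le> N + ((2 * d + 1) * N + N)"
    using Suc adj[of ?m] assms(3) by (intro add_mono) auto
  finally show ?case by (simp add: algebra_simps)
qed

text \<open>A permutation of \<open>{l..k}\<close> is a product of at most \<open>k\<close>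
  transpositions, each of cost at most \<open>2 * k * N\<close>. The lower end is free because
  \<open>l = 2\<close> leaves the top position alone, while \<open>l = 1\<close> moves all
  positions.\<close>

lemma permutation_le_adj_swaps:
  fixes D :: "(nat \<Rightarrow> nat) \<Rightarrow> nat"
  assumes id: "D id = 0"
    and sub: "\<And>v w. v permutes {l..k} \<Longrightarrow> w permutes {l..k} \<Longrightarrow> D (v \<circ> w) \<le> D v + D w"
    and adj: "\<And>j. l \<le> j \<Longrightarrow> j < k \<Longrightarrow> D (adj_swap j) \<le> N"
    and l: "l \<ge> 1" and w: "w permutes {l..k}"
  shows "D w \<le> 2 * k\<^sup>2 * N"
proof -
  have tr: "D (swap x y) \<le> 2 * k * N" if "x \<in> {l..k}" "y \<in> {l..k}" for x y
  proof -
    have less: "D (swap x y) \<le> 2 * k * N" if "x < y" "x \<in> {l..k}" "y \<in> {l..k}" for x y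
    proof -
      obtain d where d: "y = Suc (x + d)" using \<open>x < y\<close> less_iff_Suc_add by auto
      have "D (swap x y) \<le> (2 * d + 1) * N"
        unfolding d using transpose_le_adj_swaps[where D = D, OF sub adj] that d by auto
      also have "\<dots> \<le> 2 * k * N" using d that by (intro mult_right_mono) auto
      finally show ?thesis .
    qed
    consider "x < y" | "y < x" | "x = y" by linarith
    then show ?thesis
    proof cases
      case 2
      then show ?thesis using less[of y x] that by (simp add: transpose_commute[of x y])
    qed (use less[of x y] that id in auto)
  qed
  have "D w \<le> card S * (2 * k * N)" if "finite S" "S \<subseteq> {l..k}" "w permutes S" for S w
    using that
  proof (induction S arbitrary: w rule: finite_induct)
    case empty
    then show ?case using id by (simp flip: id_def)
  next
    case (insert x S)
    \<comment> \<open>Multiplying by this transposition makes \<open>x\<close> a fixed point and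
      shrinks the support to \<open>S\<close>.\<close>
    let ?w = "swap x (w x) \<circ> w"
    have w': "?w permutes S" using insert by (intro permutes_insert_lemma) auto
    have e: "w = swap x (w x) \<circ> ?w" by (simp add: fun_eq_iff)
    have wx: "w x \<in> {l..k}" "x \<in> {l..k}"
      using insert.prems permutes_in_image[of w "insert x S" x] by auto
    have "D w \<le> D (swap x (w x)) + D ?w"
      using sub[OF permutes_swap_id[OF wx(2,1)] permutes_subset[OF w']] e insert.prems(1) by simp
    also have "\<dots> \<le> 2 * k * N + card S * (2 * k * N)"
      using tr[OF wx(2,1)] insert.IH[OF _ w'] insert.prems(1) by (intro add_mono) blast+
    finally show ?case using insert by simp
  qed
  from this[OF _ order.refl w] have "D w \<le> (Suc k - l) * (2 * k * N)" by simp
  also have "\<dots> \<le> k * (2 * k * N)" using l by (intro mult_right_mono) auto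
  finally show ?thesis by (simp add: power2_eq_square algebra_simps)
qed

subsection \<open>A single voter\<close>

definition perms :: "nat \<Rightarrow> (nat \<Rightarrow> nat) set" where
  "perms k = {p. p permutes {1..k}}"

lemma finite_perms [simp]: "finite (perms k)"
  unfolding perms_def by (simp add: finite_permutations)

lemma card_perms: "card (perms k) = fact k"
  unfolding perms_def by (simp add: card_permutations)

lemma perms_comp: "p \<in> perms k \<Longrightarrow> w permutes {1..k} \<Longrightarrow> w \<circ> p \<in> perms k"
  unfolding perms_def by (simp add: permutes_compose)

lemma perms_adj_swap: "p \<in> perms k \<Longrightarrow> 1 \<le> j \<Longrightarrow> j < k \<Longrightarrow> adj_swap j \<circ> p \<in> perms k"
  by (intro perms_comp adj_swap_permutes)

lemma perms_inj: "p \<in> perms k \<Longrightarrow> p x = p y \<longleftrightarrow> x = y"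
  unfolding perms_def mem_Collect_eq by (rule inj_eq[OF permutes_inj])

text \<open>Exchanging alternatives acts on the right of a position map, exchanging positions on the
  left; this passes between the two.\<close>

lemma comp_swap: "q \<in> perms k \<Longrightarrow> q \<circ> swap a b = swap (q a) (q b) \<circ> q"
  by (simp add: fun_eq_iff Transposition.transpose_def perms_inj)

lemma perms_in: "p \<in> perms k \<Longrightarrow> p x \<in> {1..k} \<longleftrightarrow> x \<in> {1..k}"
  unfolding perms_def mem_Collect_eq by (rule permutes_in_image)

lemma permutes_tail_imp_permutes: "w permutes {2..k} \<Longrightarrow> w permutes {1..k::nat}"
  by (erule permutes_subset) auto

lemma card_preimage_le:
  assumes "finite N" "inj_on g A"
  shows "card {x \<in> A. g x \<in> N} \<le> card N"
  using assms(1) by (intro card_inj_on_le[of g] inj_on_subset[OF assms(2)]) auto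

lemma card_preimage_comp_le:
  assumes "finite N" "w permutes {1..k}"
  shows "card {p \<in> perms k. w \<circ> p \<in> N} \<le> card N"
proof (rule card_preimage_le[OF assms(1)])
  show "inj_on ((\<circ>) w) (perms k)"
    using permutes_inv_o(2)[OF assms(2)] by (intro inj_onI) (metis comp_assoc id_comp)
qed

text \<open>
  With \<open>p\<close> the position map of a ranking, the swap of two neighbours is \<open>adj_swap j \<circ> p\<close>.
  Away from manipulable profiles such a swap can change the outcome only from the upper to
  the lower of the two swapped alternatives.
\<close>

definition tame1 :: "nat \<Rightarrow> ((nat \<Rightarrow> nat) \<Rightarrow> nat) \<Rightarrow> (nat \<Rightarrow> nat) set \<Rightarrow> bool" where
  "tame1 k h N \<longleftrightarrow> N \<subseteq> perms k \<and> h ` perms k \<subseteq> {1..k} \<and>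
     (\<forall>p\<in>perms k. \<forall>j\<in>{1..<k}. p \<notin> N \<longrightarrow> adj_swap j \<circ> p \<notin> N \<longrightarrow> h p \<noteq> h (adj_swap j \<circ> p) \<longrightarrow>
        p (h p) = j \<and> p (h (adj_swap j \<circ> p)) = Suc j)"

lemma tame1D:
  assumes "tame1 k h N" "p \<in> perms k" "1 \<le> j" "j < k" "p \<notin> N" "adj_swap j \<circ> p \<notin> N"
    "h p \<noteq> h (adj_swap j \<circ> p)"
  shows "p (h p) = j" "p (h (adj_swap j \<circ> p)) = Suc j"
  using assms unfolding tame1_def by auto

text \<open>The cycle carrying position \<open>Suc m\<close> to position 1, as a word of
  \<open>m\<close> neighbour swaps with the one farthest from the top applied first, so that a
  property can be followed swap by swap.\<close>

primrec to_top :: "nat \<Rightarrow> nat \<Rightarrow> nat" where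
  "to_top 0 = id"
| "to_top (Suc m) = to_top m \<circ> adj_swap (Suc m)"

lemma to_top_permutes: "m < k \<Longrightarrow> to_top m permutes {1..k}"
proof (induction m)
  case 0
  show ?case unfolding to_top.simps by (rule permutes_id)
next
  case (Suc m)
  then show ?case unfolding to_top.simps
    by (intro permutes_compose adj_swap_permutes) auto
qed

lemma to_top_apply: "to_top m (Suc m) = 1"
  by (induction m) auto

text \<open>Each of the \<open>m\<close> swaps can lose \<open>P\<close> only when the ranking
  before or after it lies in \<open>N\<close>; as swaps act injectively on rankings, each loses at
  most \<open>2 * card N\<close> of them.\<close>

lemma card_not_preserved_to_top:
  assumes N: "finite N" and m: "m < k"
    and up: "\<And>p m. p \<in> perms k \<Longrightarrow> p b = Suc (Suc m) \<Longrightarrow> Suc m < k \<Longrightarrow> P p \<Longrightarrow> p \<notin> N \<Longrightarrow>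
      adj_swap (Suc m) \<circ> p \<notin> N \<Longrightarrow> P (adj_swap (Suc m) \<circ> p)"
  shows "card {p \<in> perms k. p b = Suc m \<and> P p \<and> \<not> P (to_top m \<circ> p)} \<le> 2 * m * card N"
  using m
proof (induction m)
  case 0
  then show ?case by simp
next
  case (Suc m)
  let ?t = "adj_swap (Suc m)"
  let ?A = "{p \<in> perms k. p b = Suc m \<and> P p \<and> \<not> P (to_top m \<circ> p)}"
  have t: "?t permutes {1..k}" using Suc.prems by (intro adj_swap_permutes) auto
  have "{p \<in> perms k. p b = Suc (Suc m) \<and> P p \<and> \<not> P (to_top (Suc m) \<circ> p)}
      \<subseteq> {p \<in> perms k. ?t \<circ> p \<in> ?A} \<union> (N \<union> {p \<in> perms k. ?t \<circ> p \<in> N})"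
  proof
    fix p assume p: "p \<in> {p \<in> perms k. p b = Suc (Suc m) \<and> P p \<and> \<not> P (to_top (Suc m) \<circ> p)}"
    have "(?t \<circ> p) b = Suc m" "?t \<circ> p \<in> perms k" using p perms_comp[OF _ t] by auto
    then show "p \<in> {p \<in> perms k. ?t \<circ> p \<in> ?A} \<union> (N \<union> {p \<in> perms k. ?t \<circ> p \<in> N})"
      using p up[of p m] Suc.prems by (auto simp: comp_assoc)
  qed
  then have "card {p \<in> perms k. p b = Suc (Suc m) \<and> P p \<and> \<not> P (to_top (Suc m) \<circ> p)}
      \<le> card ({p \<in> perms k. ?t \<circ> p \<in> ?A} \<union> (N \<union> {p \<in> perms k. ?t \<circ> p \<in> N}))"
    using N by (intro card_mono) auto
  also have "\<dots> \<le> card {p \<in> perms k. ?t \<circ> p \<in> ?A} + (card N + card {p \<in> perms k. ?t \<circ> p \<in> N})"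
    by (meson add_left_mono card_Un_le order_trans)
  also have "\<dots> \<le> card ?A + (card N + card N)"
    by (intro add_mono card_preimage_comp_le[OF _ t] order.refl) (use N in auto)
  also have "\<dots> \<le> 2 * m * card N + (card N + card N)"
    by (rule add_right_mono[OF Suc.IH[OF Suc_lessD[OF Suc.prems]]])
  also have "\<dots> = 2 * Suc m * card N" by simp
  finally show ?case .
qed

text \<open>Rankings are sorted by the position of \<open>b\<close>, and each of the
  \<open>k\<close> classes is lifted separately. A ranking that keeps \<open>P\<close> lands among
  those with \<open>b\<close> on top, injectively within a class.\<close>

lemma card_le_card_at_top:
  assumes N: "finite N" and b: "b \<in> {1..k}"
    and up: "\<And>p m. p \<in> perms k \<Longrightarrow> p b = Suc (Suc m) \<Longrightarrow> Suc m < k \<Longrightarrow> P p \<Longrightarrow> p \<notin> N \<Longrightarrow>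
      adj_swap (Suc m) \<circ> p \<notin> N \<Longrightarrow> P (adj_swap (Suc m) \<circ> p)"
  shows "card {p \<in> perms k. P p} \<le> 2 * k\<^sup>2 * card N + k * card {p \<in> perms k. p b = 1 \<and> P p}"
proof -
  let ?T = "{p \<in> perms k. p b = 1 \<and> P p}"
  let ?A = "\<lambda>m. {p \<in> perms k. p b = Suc m \<and> P p \<and> \<not> P (to_top m \<circ> p)}"
  let ?B = "\<lambda>m. {p \<in> perms k. to_top m \<circ> p \<in> ?T}"
  have "{p \<in> perms k. P p} \<subseteq> (\<Union>m<k. ?A m \<union> ?B m)"
  proof
    fix p assume p: "p \<in> {p \<in> perms k. P p}"
    then have "p b \<in> {1..k}" using b perms_in by blast
    then obtain m where m: "p b = Suc m" "m < k" by (cases "p b") auto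
    have "(to_top m \<circ> p) b = 1" "to_top m \<circ> p \<in> perms k"
      using p m perms_comp[OF _ to_top_permutes[OF m(2)]] to_top_apply by auto
    then show "p \<in> (\<Union>m<k. ?A m \<union> ?B m)" using p m by auto
  qed
  then have "card {p \<in> perms k. P p} \<le> card (\<Union>m<k. ?A m \<union> ?B m)"
    by (intro card_mono) auto
  also have "\<dots> \<le> (\<Sum>m<k. card (?A m \<union> ?B m))" by (rule card_UN_le) auto
  also have "\<dots> \<le> (\<Sum>m<k. 2 * k * card N + card ?T)"
  proof (rule sum_mono)
    fix m assume "m \<in> {..<k}"
    then have m: "m < k" by simp
    have "card (?A m \<union> ?B m) \<le> card (?A m) + card (?B m)" by (rule card_Un_le)
    also have "\<dots> \<le> 2 * m * card N + card ?T"
      using card_not_preserved_to_top[where P = P, OF N m up] 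
        card_preimage_comp_le[OF _ to_top_permutes[OF m], of ?T]
      by (intro add_mono) auto
    also have "\<dots> \<le> 2 * k * card N + card ?T" using m by auto
    finally show "card (?A m \<union> ?B m) \<le> 2 * k * card N + card ?T" .
  qed
  finally show ?thesis by (simp add: power2_eq_square algebra_simps)
qed

text \<open>The product is at least half the smaller number times the sum, and the hypotheses bound
  it by \<open>c\<close> times the sum.\<close>

lemma min_le_of_mult_le:
  fixes x y w c :: nat
  assumes "x * y \<le> w * c" "w \<le> x + y"
  shows "x \<le> 2 * c \<or> y \<le> 2 * c"
proof (rule ccontr)
  assume a: "\<not> ?thesis"
  have "x * y \<le> (x + y) * c" using assms by (meson mult_le_mono1 order_trans)
  then have "x * y \<le> x * c + y * c" by (simp only: add_mult_distrib)
  moreover have "x * (2 * c) < x * y" using a by (intro mult_strict_left_mono) auto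
  then have "2 * (x * c) < x * y" by (simp only: mult.left_commute)
  moreover have "y * (2 * c) < y * x" using a by (intro mult_strict_left_mono) auto
  then have "2 * (y * c) < x * y" by (simp only: mult.left_commute mult.commute[of y x])
  ultimately show False by linarith
qed

text \<open>Permuting the positions below the top connects any ranking of the first set with any of
  the second, and swaps of such positions rarely alter whether \<open>b\<close> wins. Counting
  connected pairs bounds the product of the two sizes, so the smaller one is small.\<close>

lemma top_dichotomy:
  assumes tame: "tame1 k h N" and b: "b \<in> {1..k}"
  shows "card {p \<in> perms k. p b = 1 \<and> h p = b} \<le> 8 * k\<^sup>2 * card N \<or>
    card {p \<in> perms k. p b = 1 \<and> h p \<noteq> b} \<le> 8 * k\<^sup>2 * card N"
proof -
  let ?X = "{p \<in> perms k. p b = 1 \<and> h p = b}" and ?Y = "{p \<in> perms k. p b = 1 \<and> h p \<noteq> b}"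
  let ?W = "{w. w permutes {2..k}}"
  have k: "k \<ge> 1" using b by auto
  have finN: "finite N" using tame finite_subset unfolding tame1_def by fastforce
  have finW: "finite ?W" by (simp add: finite_permutations)
  have cW: "card ?W = fact (k - 1)" by (subst card_permutations[of "{2..k}" "k - 1"]) auto
  define S where "S w = {p \<in> perms k. p b = 1 \<and> (h p = b) \<noteq> (h (w \<circ> p) = b)}" for w
  have finS: "finite (S w)" for w unfolding S_def by simp
  have fix1: "w 1 = 1" if "w permutes {2..k}" for w
    using permutes_not_in[OF that, of 1] by simp
  have DS: "card (S w) \<le> 2 * k\<^sup>2 * (2 * card N)" if "w permutes {2..k}" for w
  proof (rule permutation_le_adj_swaps[where l = 2 and D = "\<lambda>w. card (S w)", OF _ _ _ _ that])
    show "card (S id) = 0" unfolding S_def by simp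
  next
    fix v w assume v: "v permutes {2..k}" and w: "w permutes {2..k}"
    have "S (v \<circ> w) \<subseteq> {p \<in> perms k. w \<circ> p \<in> S v} \<union> S w"
      unfolding S_def using perms_comp[OF _ permutes_tail_imp_permutes[OF w]] fix1[OF w]
      by (auto simp: comp_assoc)
    then have "card (S (v \<circ> w)) \<le> card ({p \<in> perms k. w \<circ> p \<in> S v} \<union> S w)"
      using finS by (intro card_mono) auto
    also have "\<dots> \<le> card {p \<in> perms k. w \<circ> p \<in> S v} + card (S w)" by (rule card_Un_le)
    also have "\<dots> \<le> card (S v) + card (S w)"
      using card_preimage_comp_le[OF finS permutes_tail_imp_permutes[OF w]] by simp
    finally show "card (S (v \<circ> w)) \<le> card (S v) + card (S w)" .
  next
    fix j assume j: "2 \<le> j" "j < k"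
    have t: "adj_swap j permutes {1..k}" using j by (intro adj_swap_permutes) auto
    have "S (adj_swap j) \<subseteq> N \<union> {p \<in> perms k. adj_swap j \<circ> p \<in> N}"
    proof
      fix p assume p: "p \<in> S (adj_swap j)"
      show "p \<in> N \<union> {p \<in> perms k. adj_swap j \<circ> p \<in> N}"
      proof (rule ccontr)
        assume "\<not> ?thesis"
        \<comment> \<open>The outcomes before and after would sit at positions \<open>j\<close> and
          \<open>Suc j\<close>, both at least 2, whereas one of them is \<open>b\<close> at position
          1.\<close>
        then have "p (h p) = j" "p (h (adj_swap j \<circ> p)) = Suc j"
          using tame1D[OF tame, of p j] p j unfolding S_def by auto
        then show False using p j unfolding S_def by auto
      qed
    qed
    then have "card (S (adj_swap j)) \<le> card (N \<union> {p \<in> perms k. adj_swap j \<circ> p \<in> N})"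
      using finN by (intro card_mono) auto
    also have "\<dots> \<le> card N + card {p \<in> perms k. adj_swap j \<circ> p \<in> N}" by (rule card_Un_le)
    also have "\<dots> \<le> 2 * card N" using card_preimage_comp_le[OF finN t] by simp
    finally show "card (S (adj_swap j)) \<le> 2 * card N" .
  qed simp
  \<comment> \<open>A pair \<open>(p, q)\<close> is recovered from \<open>p\<close> and
    \<open>q \<circ> inv p\<close>, and the latter fixes position 1 since both rankings have
    \<open>b\<close> there.\<close>
  have "?X \<times> ?Y \<subseteq> (\<Union>w\<in>?W. (\<lambda>p. (p, w \<circ> p)) ` S w)"
  proof
    fix z assume "z \<in> ?X \<times> ?Y"
    then obtain p q where z: "z = (p, q)" and p: "p \<in> ?X" and q: "q \<in> ?Y" by blast
    let ?w = "q \<circ> inv p"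
    have pp: "p permutes {1..k}" and qq: "q permutes {1..k}" using p q by (auto simp: perms_def)
    have e: "?w \<circ> p = q" using permutes_inv_o(2)[OF pp] by (simp add: comp_assoc)
    have w1: "?w permutes {1..k}" using pp qq by (intro permutes_compose permutes_inv)
    have "?w 1 = 1" using fun_cong[OF e, of b] p q by simp
    have "?w permutes {2..k}"
    proof (rule permutes_superset[rotated])
      fix x assume "x \<in> {1..k} - {2..k}"
      then have "x = 1" by auto
      then show "?w x = x" using \<open>?w 1 = 1\<close> by simp
    qed (rule w1)
    then show "z \<in> (\<Union>w\<in>?W. (\<lambda>p. (p, w \<circ> p)) ` S w)"
      using p q e unfolding z S_def by (auto intro!: bexI[of _ ?w] image_eqI[of _ _ p])
  qed
  then have "card (?X \<times> ?Y) \<le> card (\<Union>w\<in>?W. (\<lambda>p. (p, w \<circ> p)) ` S w)"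
    using finS finW by (intro card_mono) auto
  also have "\<dots> \<le> (\<Sum>w\<in>?W. card ((\<lambda>p. (p, w \<circ> p)) ` S w))" by (rule card_UN_le[OF finW])
  also have "\<dots> \<le> (\<Sum>w\<in>?W. 4 * k\<^sup>2 * card N)"
    using DS card_image_le[OF finS] by (intro sum_mono) (fastforce intro: order_trans)
  finally have XY: "card ?X * card ?Y \<le> card ?W * (4 * k\<^sup>2 * card N)"
    by (simp add: card_cartesian_product)
  have sum: "card ?W \<le> card ?X + card ?Y"
  proof -
    have p0: "swap 1 b permutes {1..k}" using b k by (intro permutes_swap_id) auto
    \<comment> \<open>Precomposing with \<open>swap 1 b\<close> turns each \<open>w\<close> fixing 1
      into a position map with \<open>b\<close> on top.\<close>
    have "card ?W \<le> card (?X \<union> ?Y)"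
    proof (rule card_inj_on_le[of "\<lambda>w. w \<circ> swap 1 b"])
      show "inj_on (\<lambda>w. w \<circ> swap 1 b) ?W"
        by (rule inj_onI) (metis comp_assoc comp_id transpose_comp_involutory)
      show "(\<lambda>w. w \<circ> swap 1 b) ` ?W \<subseteq> ?X \<union> ?Y"
        using p0 fix1 permutes_tail_imp_permutes
        by (auto simp: perms_def permutes_compose)
    qed simp
    also have "\<dots> \<le> card ?X + card ?Y" by (rule card_Un_le)
    finally show ?thesis .
  qed
  show ?thesis
    using min_le_of_mult_le[OF XY sum] by (simp add: mult.assoc)
qed

text \<open>Outside \<open>N\<close> both events survive lifting \<open>b\<close> past a neighbour,
  so their counts are controlled by the rankings with \<open>b\<close> on top. There the events are
  complementary, and \<open>top_dichotomy\<close> makes one of them rare. The constant 10 is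
  \<open>2 + 8\<close>.\<close>

lemma outcome_dichotomy:
  assumes tame: "tame1 k h N" and b: "b \<in> {1..k}"
  shows "card {p \<in> perms k. h p = b} \<le> 10 * k ^ 3 * card N \<or>
    card {p \<in> perms k. p b < p (h p)} \<le> 10 * k ^ 3 * card N"
proof -
  have finN: "finite N" using tame finite_subset unfolding tame1_def by fastforce
  have h: "h p \<in> {1..k}" if "p \<in> perms k" for p using tame that unfolding tame1_def by auto
  have arith: "c \<le> 10 * k ^ 3 * card N"
    if "c \<le> 2 * k\<^sup>2 * card N + k * d" "d \<le> 8 * k\<^sup>2 * card N" for c d
  proof -
    have "k * d \<le> k * (8 * k\<^sup>2 * card N)" using that by simp
    moreover have "k\<^sup>2 * card N \<le> k ^ 3 * card N"
      using b by (intro mult_right_mono power_increasing) auto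
    moreover have "k * (8 * k\<^sup>2 * card N) = 8 * (k ^ 3 * card N)"
      by (simp add: power2_eq_square power3_eq_cube)
    ultimately show ?thesis using that(1) by linarith
  qed
  have 1: "card {p \<in> perms k. h p = b}
      \<le> 2 * k\<^sup>2 * card N + k * card {p \<in> perms k. p b = 1 \<and> h p = b}"
  proof (rule card_le_card_at_top[OF finN b])
    fix p m assume a: "p \<in> perms k" "p b = Suc (Suc m)" "Suc m < k" "h p = b" "p \<notin> N"
      "adj_swap (Suc m) \<circ> p \<notin> N"
    \<comment> \<open>A change would require the winner to be at position \<open>Suc m\<close>, but
      the winner \<open>b\<close> is one place lower.\<close>
    show "h (adj_swap (Suc m) \<circ> p) = b"
      using tame1D(1)[OF tame a(1) _ a(3) a(5,6)] a by fastforce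
  qed
  have 2: "card {p \<in> perms k. p b < p (h p)}
      \<le> 2 * k\<^sup>2 * card N + k * card {p \<in> perms k. p b = 1 \<and> p b < p (h p)}"
  proof (rule card_le_card_at_top[OF finN b])
    fix p m assume a: "p \<in> perms k" "p b = Suc (Suc m)" "Suc m < k" "p b < p (h p)" "p \<notin> N"
      "adj_swap (Suc m) \<circ> p \<notin> N"
    \<comment> \<open>Here the winner is below \<open>b\<close>, hence not at position
      \<open>Suc m\<close> as a change would require; the swap does not move it either.\<close>
    have "h (adj_swap (Suc m) \<circ> p) = h p"
      using tame1D(1)[OF tame a(1) _ a(3) a(5,6)] a by fastforce
    then show "(adj_swap (Suc m) \<circ> p) b < (adj_swap (Suc m) \<circ> p) (h (adj_swap (Suc m) \<circ> p))"
      using a by (simp add: Transposition.transpose_def)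
  qed
  have e: "{p \<in> perms k. p b = 1 \<and> p b < p (h p)} = {p \<in> perms k. p b = 1 \<and> h p \<noteq> b}"
  proof -
    have "p b < p (h p) \<longleftrightarrow> h p \<noteq> b" if "p \<in> perms k" "p b = 1" for p
    proof
      assume "h p \<noteq> b"
      then have "p (h p) \<noteq> 1" "p (h p) \<in> {1..k}"
        using perms_inj[OF that(1), of "h p" b] perms_in[OF that(1)] h[OF that(1)] that by auto
      then show "p b < p (h p)" using that by auto
    qed auto
    then show ?thesis by auto
  qed
  from top_dichotomy[OF tame b] show ?thesis
    using arith[OF 1] arith[OF 2[unfolded e]] by blast
qed

text \<open>\<open>H\<close> consists of the alternatives rarely above the winner; by the dichotomy
  those outside \<open>H\<close> rarely win. Off the union of these \<open>k\<close> rare events the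
  winner is in \<open>H\<close> and no element of \<open>H\<close> is above it.\<close>

lemma single_voter_near_top:
  assumes tame: "tame1 k h N" and small: "10 * k ^ 4 * card N < fact k"
  obtains H where "H \<noteq> {}" "H \<subseteq> {1..k}"
    "card {p \<in> perms k. \<not> (h p \<in> H \<and> (\<forall>b\<in>H. p (h p) \<le> p b))} \<le> 10 * k ^ 4 * card N"
proof -
  let ?H = "{b \<in> {1..k}. card {p \<in> perms k. p b < p (h p)} \<le> 10 * k ^ 3 * card N}"
  let ?E = "\<lambda>b. if b \<in> ?H then {p \<in> perms k. p b < p (h p)} else {p \<in> perms k. h p = b}"
  let ?B = "{p \<in> perms k. \<not> (h p \<in> ?H \<and> (\<forall>b\<in>?H. p (h p) \<le> p b))}"
  have h: "h p \<in> {1..k}" if "p \<in> perms k" for p using tame that unfolding tame1_def by auto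
  have cE: "card (?E b) \<le> 10 * k ^ 3 * card N" if "b \<in> {1..k}" for b
    using outcome_dichotomy[OF tame that] that by (cases "b \<in> ?H") auto
  have "?B \<subseteq> (\<Union>b\<in>{1..k}. ?E b)"
  proof
    fix p assume p: "p \<in> ?B"
    then have pk: "p \<in> perms k" by simp
    show "p \<in> (\<Union>b\<in>{1..k}. ?E b)"
    proof (cases "h p \<in> ?H")
      case False
      then show ?thesis using pk h[OF pk] by (intro UN_I[of "h p"]) auto
    next
      case True
      then obtain b where "b \<in> ?H" "p b < p (h p)" using p by force
      then show ?thesis using pk by (intro UN_I[of b]) auto
    qed
  qed
  then have "card ?B \<le> card (\<Union>b\<in>{1..k}. ?E b)" by (intro card_mono) auto
  also have "\<dots> \<le> (\<Sum>b\<in>{1..k}. card (?E b))" by (rule card_UN_le) auto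
  also have "\<dots> \<le> (\<Sum>b\<in>{1..k}. 10 * k ^ 3 * card N)" by (rule sum_mono[OF cE])
  also have "\<dots> = 10 * k ^ 4 * card N" by (simp add: power_numeral_reduce)
  finally have cB: "card ?B \<le> 10 * k ^ 4 * card N" .
  \<comment> \<open>With \<open>?H\<close> empty every ranking would be bad, which
    \<open>small\<close> excludes.\<close>
  have "?H \<noteq> {}"
  proof
    assume "?H = {}"
    then have "?B = perms k" by auto
    then show False using cB small card_perms[of k] by simp
  qed
  with cB show ?thesis by (intro that[of ?H]) auto
qed

subsection \<open>Profiles and the reduction to one voter\<close>

definition perm_profiles :: "nat \<Rightarrow> nat \<Rightarrow> (nat \<Rightarrow> nat \<Rightarrow> nat) set" where
  "perm_profiles n k = {1..n} \<rightarrow>\<^sub>E perms k"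

lemma finite_perm_profiles [simp]: "finite (perm_profiles n k)"
  unfolding perm_profiles_def by (simp add: finite_PiE)

lemma perm_profiles_nth: "\<sigma> \<in> perm_profiles n k \<Longrightarrow> i \<in> {1..n} \<Longrightarrow> \<sigma> i \<in> perms k"
  unfolding perm_profiles_def by blast

lemma perm_profiles_upd:
  "\<sigma> \<in> perm_profiles n k \<Longrightarrow> i \<in> {1..n} \<Longrightarrow> p \<in> perms k \<Longrightarrow> \<sigma>(i := p) \<in> perm_profiles n k"
  unfolding perm_profiles_def PiE_iff extensional_def by simp

lemma perm_profiles_nonempty: "perm_profiles n k \<noteq> {}"
  unfolding perm_profiles_def perms_def PiE_eq_empty_iff using permutes_id by blast

text \<open>The analogue of \<open>tame1\<close> for profiles. \<open>N\<close> is left arbitrary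
  because it will hold the manipulable profiles and, in the two-valued case, also those where
  \<open>F\<close> differs from its approximation.\<close>

definition tame :: "nat \<Rightarrow> nat \<Rightarrow> ((nat \<Rightarrow> nat \<Rightarrow> nat) \<Rightarrow> nat) \<Rightarrow> (nat \<Rightarrow> nat \<Rightarrow> nat) set \<Rightarrow> bool" where
  "tame n k F N \<longleftrightarrow> N \<subseteq> perm_profiles n k \<and> F ` perm_profiles n k \<subseteq> {1..k} \<and>
     (\<forall>\<sigma>\<in>perm_profiles n k. \<forall>i\<in>{1..n}. \<forall>j\<in>{1..<k}. \<sigma> \<notin> N \<longrightarrow> \<sigma>(i := adj_swap j \<circ> \<sigma> i) \<notin> N \<longrightarrow>
        F \<sigma> \<noteq> F (\<sigma>(i := adj_swap j \<circ> \<sigma> i)) \<longrightarrow>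
        \<sigma> i (F \<sigma>) = j \<and> \<sigma> i (F (\<sigma>(i := adj_swap j \<circ> \<sigma> i))) = Suc j)"

lemma tameD:
  assumes "tame n k F N" "\<sigma> \<in> perm_profiles n k" "i \<in> {1..n}" "1 \<le> j" "j < k" "\<sigma> \<notin> N"
    "\<sigma>(i := adj_swap j \<circ> \<sigma> i) \<notin> N" "F \<sigma> \<noteq> F (\<sigma>(i := adj_swap j \<circ> \<sigma> i))"
  shows "\<sigma> i (F \<sigma>) = j" "\<sigma> i (F (\<sigma>(i := adj_swap j \<circ> \<sigma> i))) = Suc j"
  using assms unfolding tame_def by auto

lemma tame_finite: "tame n k F N \<Longrightarrow> finite N"
  unfolding tame_def by (elim conjE finite_subset) simp

lemma tame_section:
  assumes "tame n k F N" "\<zeta> \<in> perm_profiles n k" "i \<in> {1..n}"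
  shows "tame1 k (\<lambda>p. F (\<zeta>(i := p))) {p \<in> perms k. \<zeta>(i := p) \<in> N}"
  unfolding tame1_def
proof (intro conjI ballI impI)
  show "(\<lambda>p. F (\<zeta>(i := p))) ` perms k \<subseteq> {1..k}"
    using assms(1) perm_profiles_upd[OF assms(2,3)] unfolding tame_def by (auto simp: image_subset_iff)
next
  fix p j assume p: "p \<in> perms k" and j: "j \<in> {1..<k}"
    and nN: "p \<notin> {p \<in> perms k. \<zeta>(i := p) \<in> N}"
      "adj_swap j \<circ> p \<notin> {p \<in> perms k. \<zeta>(i := p) \<in> N}"
    and ne: "F (\<zeta>(i := p)) \<noteq> F (\<zeta>(i := adj_swap j \<circ> p))"
  have q: "adj_swap j \<circ> p \<in> perms k" using p j by (intro perms_adj_swap) auto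
  note D = tameD[OF assms(1) perm_profiles_upd[OF assms(2,3) p] assms(3), of j]
  show "p (F (\<zeta>(i := p))) = j" using D(1) j nN ne p q by simp
  show "p (F (\<zeta>(i := adj_swap j \<circ> p))) = Suc j" using D(2) j nN ne p q by simp
qed auto

text \<open>Trading coordinate \<open>i\<close> for a spare ranking is an involution; it plays the
  part of Fubini in the counts of sections and cylinders.\<close>

lemma inj_on_exchange:
  fixes i :: 'a and A :: "(('a \<Rightarrow> 'b) \<times> 'b) set"
  shows "inj_on (\<lambda>(\<sigma>, p). (\<sigma>(i := p), \<sigma> i)) A"
proof (rule inj_on_inverseI)
  show "(\<lambda>(\<sigma>, p). (\<sigma>(i := p), \<sigma> i)) ((\<lambda>(\<sigma>, p). (\<sigma>(i := p), \<sigma> i)) x) = x" for x :: "('a \<Rightarrow> 'b) \<times> 'b"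
    by (cases x) simp
qed

lemma sum_card_sections_le:
  assumes "i \<in> {1..n}" "finite S"
  shows "(\<Sum>\<zeta>\<in>perm_profiles n k. card {p \<in> perms k. \<zeta>(i := p) \<in> S}) \<le> fact k * card S"
proof -
  let ?T = "SIGMA \<zeta>:perm_profiles n k. {p \<in> perms k. \<zeta>(i := p) \<in> S}"
  have "(\<Sum>\<zeta>\<in>perm_profiles n k. card {p \<in> perms k. \<zeta>(i := p) \<in> S}) = card ?T"
    by (subst card_SigmaI) auto
  also have "\<dots> \<le> card (S \<times> perms k)"
    using assms perm_profiles_nth
    by (intro card_inj_on_le[OF inj_on_exchange[of i]]) auto
  finally show ?thesis by (simp add: card_cartesian_product card_perms mult.commute)
qed

lemma card_cylinder_le:
  assumes "i \<in> {1..n}" "finite A"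
  shows "card {\<sigma> \<in> perm_profiles n k. \<sigma> i \<in> A} * fact k \<le> card (perm_profiles n k) * card A"
proof -
  have "card ({\<sigma> \<in> perm_profiles n k. \<sigma> i \<in> A} \<times> perms k) \<le> card (perm_profiles n k \<times> A)"
    using assms perm_profiles_upd
    by (intro card_inj_on_le[OF inj_on_exchange[of i]]) auto
  then show ?thesis by (simp add: card_cartesian_product card_perms)
qed

text \<open>Averaging gives a profile \<open>\<zeta>\<close> whose section in voter \<open>i\<close>
  meets \<open>N\<close> and \<open>B\<close> with at most their overall density. The single-voter
  result applies there, passes to \<open>h\<close> off \<open>B\<close>, and thence to all profiles,
  since \<open>h\<close> sees voter \<open>i\<close> alone.\<close>

lemma near_one_voter_near_top:
  assumes tame: "tame n k F N" and i: "i \<in> {1..n}" and k: "k \<ge> 1"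
    and B: "B = {\<sigma> \<in> perm_profiles n k. F \<sigma> \<noteq> h (\<sigma> i)}"
    and small: "10 * k ^ 4 * (card N + card B) < card (perm_profiles n k)"
  obtains H where "H \<noteq> {}" "H \<subseteq> {1..k}"
    "card {\<sigma> \<in> perm_profiles n k. \<not> (F \<sigma> \<in> H \<and> (\<forall>b\<in>H. \<sigma> i (F \<sigma>) \<le> \<sigma> i b))}
      \<le> card B + 10 * k ^ 4 * (card N + card B)"
proof -
  let ?Q = "perm_profiles n k"
  define N' where "N' \<zeta> = {p \<in> perms k. \<zeta>(i := p) \<in> N}" for \<zeta>
  define B' where "B' \<zeta> = {p \<in> perms k. \<zeta>(i := p) \<in> B}" for \<zeta>
  have finN: "finite N" by (rule tame_finite[OF tame])
  have finB: "finite B" unfolding B by simp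
  have Q0: "card ?Q > 0" using perm_profiles_nonempty by (simp add: card_gt_0_iff)
  have "\<exists>\<zeta>\<in>?Q. (card (N' \<zeta>) + card (B' \<zeta>)) * card ?Q \<le> (card N + card B) * fact k"
  proof (rule ccontr)
    assume "\<not> ?thesis"
    then have "(\<Sum>\<zeta>\<in>?Q. (card N + card B) * fact k) < (\<Sum>\<zeta>\<in>?Q. (card (N' \<zeta>) + card (B' \<zeta>)) * card ?Q)"
      using perm_profiles_nonempty by (intro sum_strict_mono) (auto simp: not_le)
    also have "\<dots> = ((\<Sum>\<zeta>\<in>?Q. card (N' \<zeta>)) + (\<Sum>\<zeta>\<in>?Q. card (B' \<zeta>))) * card ?Q"
      by (simp only: sum_distrib_right[symmetric] sum.distrib)
    also have "\<dots> \<le> (fact k * card N + fact k * card B) * card ?Q"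
      unfolding N'_def B'_def
      by (intro mult_right_mono add_mono sum_card_sections_le[OF i] finN finB) auto
    finally show False by (simp add: algebra_simps)
  qed
  then obtain \<zeta> where \<zeta>: "\<zeta> \<in> ?Q"
    and av: "(card (N' \<zeta>) + card (B' \<zeta>)) * card ?Q \<le> (card N + card B) * fact k" by blast
  let ?h = "\<lambda>p. F (\<zeta>(i := p))"
  have tame1: "tame1 k ?h (N' \<zeta>)" unfolding N'_def by (rule tame_section[OF tame \<zeta> i])
  have "10 * k ^ 4 * card (N' \<zeta>) * card ?Q \<le> 10 * k ^ 4 * ((card (N' \<zeta>) + card (B' \<zeta>)) * card ?Q)"
    by (simp add: algebra_simps)
  also have "\<dots> \<le> 10 * k ^ 4 * ((card N + card B) * fact k)" using av by (intro mult_left_mono) auto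
  also have "\<dots> < card ?Q * fact k"
    using mult_strict_right_mono[OF small, of "fact k"] by (simp add: mult.assoc)
  finally have "10 * k ^ 4 * card (N' \<zeta>) < fact k"
    using Q0 by (simp add: mult.commute[of "card ?Q"])
  from single_voter_near_top[OF tame1 this] obtain H where H: "H \<noteq> {}" "H \<subseteq> {1..k}"
    and cH: "card {p \<in> perms k. \<not> (?h p \<in> H \<and> (\<forall>b\<in>H. p (?h p) \<le> p b))} \<le> 10 * k ^ 4 * card (N' \<zeta>)"
    by blast
  let ?P = "{p \<in> perms k. \<not> (h p \<in> H \<and> (\<forall>b\<in>H. p (h p) \<le> p b))}"
  let ?C = "{\<sigma> \<in> ?Q. \<sigma> i \<in> ?P}"
  have "?P \<subseteq> {p \<in> perms k. \<not> (?h p \<in> H \<and> (\<forall>b\<in>H. p (?h p) \<le> p b))} \<union> B' \<zeta>"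
  proof
    fix p assume p: "p \<in> ?P"
    show "p \<in> {p \<in> perms k. \<not> (?h p \<in> H \<and> (\<forall>b\<in>H. p (?h p) \<le> p b))} \<union> B' \<zeta>"
    proof (cases "p \<in> B' \<zeta>")
      case False
      then have "?h p = h p"
        using p perm_profiles_upd[OF \<zeta> i] unfolding B'_def B by auto
      then show ?thesis using p by simp
    qed simp
  qed
  then have "card ?P \<le> card ({p \<in> perms k. \<not> (?h p \<in> H \<and> (\<forall>b\<in>H. p (?h p) \<le> p b))} \<union> B' \<zeta>)"
    by (intro card_mono) (auto simp: B'_def)
  also have "\<dots> \<le> 10 * k ^ 4 * card (N' \<zeta>) + card (B' \<zeta>)"
    using card_Un_le add_right_mono[OF cH] by (rule order_trans)
  also have "\<dots> \<le> 10 * k ^ 4 * (card (N' \<zeta>) + card (B' \<zeta>))"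
    using k by (simp add: algebra_simps)
  finally have cP: "card ?P \<le> 10 * k ^ 4 * (card (N' \<zeta>) + card (B' \<zeta>))" .
  \<comment> \<open>A cylinder over \<open>?P\<close> has the density of \<open>?P\<close>, so the
    bound for the section returns to all profiles.\<close>
  have "card ?C * fact k \<le> card ?Q * card ?P" by (rule card_cylinder_le[OF i]) simp
  also have "\<dots> \<le> card ?Q * (10 * k ^ 4 * (card (N' \<zeta>) + card (B' \<zeta>)))"
    by (rule mult_left_mono[OF cP]) simp
  also have "\<dots> = 10 * k ^ 4 * ((card (N' \<zeta>) + card (B' \<zeta>)) * card ?Q)"
    by (simp only: mult_ac)
  also have "\<dots> \<le> 10 * k ^ 4 * ((card N + card B) * fact k)" using av by (intro mult_left_mono) auto
  also have "\<dots> = 10 * k ^ 4 * (card N + card B) * fact k" by (simp only: mult.assoc)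
  finally have cC: "card ?C \<le> 10 * k ^ 4 * (card N + card B)" by simp
  have "{\<sigma> \<in> ?Q. \<not> (F \<sigma> \<in> H \<and> (\<forall>b\<in>H. \<sigma> i (F \<sigma>) \<le> \<sigma> i b))} \<subseteq> B \<union> ?C"
    using perm_profiles_nth[OF _ i] unfolding B by auto
  then have "card {\<sigma> \<in> ?Q. \<not> (F \<sigma> \<in> H \<and> (\<forall>b\<in>H. \<sigma> i (F \<sigma>) \<le> \<sigma> i b))} \<le> card (B \<union> ?C)"
    using finB by (intro card_mono) auto
  also have "\<dots> \<le> card B + 10 * k ^ 4 * (card N + card B)"
    using card_Un_le add_left_mono[OF cC] by (rule order_trans)
  finally show ?thesis by (rule that[OF H])
qed

subsection \<open>Repairing monotonicity on a cube\<close>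

text \<open>A disjoint union of cubes: points may carry more data than their up-down vector, the
  flips commute, and each toggles only its own coordinate.\<close>

locale flip_cube =
  fixes Q :: "'a set" and J :: "'i set" and flip :: "'i \<Rightarrow> 'a \<Rightarrow> 'a" and up :: "'i \<Rightarrow> 'a \<Rightarrow> bool"
  assumes fin: "finite Q" "finite J"
    and flip_in: "\<And>i x. i \<in> J \<Longrightarrow> x \<in> Q \<Longrightarrow> flip i x \<in> Q"
    and flip_flip: "\<And>i x. i \<in> J \<Longrightarrow> x \<in> Q \<Longrightarrow> flip i (flip i x) = x"
    and flip_commute: "\<And>i j x. i \<in> J \<Longrightarrow> j \<in> J \<Longrightarrow> x \<in> Q \<Longrightarrow> flip i (flip j x) = flip j (flip i x)"
    and up_flip: "\<And>i j x. i \<in> J \<Longrightarrow> j \<in> J \<Longrightarrow> x \<in> Q \<Longrightarrow> up j (flip i x) \<longleftrightarrow> (up j x \<noteq> (i = j))"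
begin

definition violations :: "'i \<Rightarrow> ('a \<Rightarrow> bool) \<Rightarrow> 'a set" where
  "violations j G = {x \<in> Q. \<not> up j x \<and> G x \<and> \<not> G (flip j x)}"

text \<open>On each edge in direction \<open>i\<close> the two values of \<open>G\<close> are
  sorted, the larger one going to the upper end.\<close>

definition compress :: "'i \<Rightarrow> ('a \<Rightarrow> bool) \<Rightarrow> 'a \<Rightarrow> bool" where
  "compress i G x \<longleftrightarrow> (if up i x then G x \<or> G (flip i x) else G x \<and> G (flip i x))"

definition up_determined :: "('a \<Rightarrow> bool) \<Rightarrow> bool" where
  "up_determined G \<longleftrightarrow> (\<forall>x\<in>Q. \<forall>y\<in>Q. (\<forall>i\<in>J. up i x = up i y) \<longrightarrow> G x = G y)"

lemma violations_in: "violations j G \<subseteq> Q"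
  unfolding violations_def by auto

lemma finite_violations [simp]: "finite (violations j G)"
  using violations_in fin finite_subset by blast

lemma inj_on_flip: "i \<in> J \<Longrightarrow> inj_on (flip i) Q"
  by (rule inj_on_inverseI[of _ "flip i"]) (rule flip_flip)

lemma flip_bij: "i \<in> J \<Longrightarrow> bij_betw (flip i) Q Q"
  by (rule bij_betw_byWitness[of _ "flip i"]) (auto simp: flip_flip flip_in)

text \<open>Counting along edges in direction \<open>i\<close> reduces inequalities between
  cardinalities to comparisons on single edges.\<close>

lemma two_card_eq_sum:
  assumes "i \<in> J" "V \<subseteq> Q"
  shows "2 * card V = (\<Sum>x\<in>Q. of_bool (x \<in> V) + of_bool (flip i x \<in> V))"
proof -
  have c: "card V = (\<Sum>x\<in>Q. of_bool (x \<in> V))"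
    using assms(2) fin by (simp add: Int_absorb1)
  also have "\<dots> = (\<Sum>x\<in>Q. of_bool (flip i x \<in> V))"
    by (rule sum.reindex_bij_betw[OF flip_bij[OF assms(1)], symmetric])
  finally show ?thesis unfolding sum.distrib using c by simp
qed

lemma violations_compress_same: "i \<in> J \<Longrightarrow> violations i (compress i G) = {}"
  unfolding violations_def compress_def by (auto simp: up_flip flip_flip)

text \<open>On each square spanned by the flips \<open>i\<close> and \<open>j\<close>, sorting the
  edges in direction \<open>i\<close> does not increase the number of badly ordered edges in
  direction \<open>j\<close>.\<close>

lemma card_violations_compress:
  assumes "i \<in> J" "j \<in> J"
  shows "card (violations j (compress i G)) \<le> card (violations j G)"
proof (cases "i = j")
  case True
  then show ?thesis using violations_compress_same[OF assms(1)] by simp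
next
  case False
  have "2 * card (violations j (compress i G)) \<le> 2 * card (violations j G)"
    unfolding two_card_eq_sum[OF assms(1) violations_in]
  proof (rule sum_mono)
    fix x assume x: "x \<in> Q"
    have fx: "flip i x \<in> Q" "flip j x \<in> Q" "flip j (flip i x) \<in> Q" "flip i (flip i x) = x"
      "up j (flip i x) = up j x" "up i (flip i x) \<longleftrightarrow> \<not> up i x" "up i (flip j x) = up i x"
      "flip i (flip j x) = flip j (flip i x)" "flip i (flip j (flip i x)) = flip j x"
      "up i (flip j (flip i x)) \<longleftrightarrow> \<not> up i x"
      using x assms False by (simp_all add: flip_in flip_flip up_flip flip_commute[of i j])
    \<comment> \<open>Both sides concern one square only; the cases run over its four values of
      \<open>G\<close> and the place of \<open>x\<close> in it.\<close>
    show "of_bool (x \<in> violations j (compress i G)) + of_bool (flip i x \<in> violations j (compress i G))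
        \<le> (of_bool (x \<in> violations j G) + of_bool (flip i x \<in> violations j G) :: nat)"
      unfolding violations_def compress_def using x
      by (cases "up i x"; cases "up j x"; cases "G x"; cases "G (flip i x)"; cases "G (flip j x)";
          cases "G (flip j (flip i x))") (simp_all add: fx)
  qed
  then show ?thesis by simp
qed

text \<open>Only edges that violate monotonicity change, and each has two ends.\<close>

lemma card_compress_neq:
  assumes "i \<in> J"
  shows "card {x \<in> Q. compress i G x \<noteq> G x} \<le> 2 * card (violations i G)"
proof -
  have "{x \<in> Q. compress i G x \<noteq> G x} \<subseteq> violations i G \<union> {x \<in> Q. flip i x \<in> violations i G}"
    using assms unfolding compress_def violations_def
    by (auto simp: up_flip flip_flip flip_in split: if_splits)
  then have "card {x \<in> Q. compress i G x \<noteq> G x}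
      \<le> card (violations i G \<union> {x \<in> Q. flip i x \<in> violations i G})"
    using fin by (intro card_mono) auto
  also have "\<dots> \<le> card (violations i G) + card (violations i G)"
    by (intro order_trans[OF card_Un_le] add_left_mono card_preimage_le inj_on_flip assms) simp
  finally show ?thesis by simp
qed

lemma up_determined_compress:
  assumes "i \<in> J" "up_determined G"
  shows "up_determined (compress i G)"
  unfolding up_determined_def
proof (intro ballI impI)
  fix x y assume x: "x \<in> Q" and y: "y \<in> Q" and u: "\<forall>i\<in>J. up i x = up i y"
  then have "\<forall>j\<in>J. up j (flip i x) = up j (flip i y)" using assms(1) by (auto simp: up_flip)
  then have "G (flip i x) = G (flip i y)" "G x = G y"
    using assms u x y flip_in[OF assms(1)] unfolding up_determined_def by blast+
  then show "compress i G x = compress i G y" using u assms(1) unfolding compress_def by auto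
qed

text \<open>Directions are compressed one after another. Violation counts never grow, so repaired
  directions stay repaired and the cost of each compression can be charged to the original
  \<open>G\<close>; the second clause carries this through the induction.\<close>

lemma monotonize:
  assumes "finite I" "I \<subseteq> J" "up_determined G"
  shows "\<exists>G'. (\<forall>i\<in>I. violations i G' = {}) \<and>
    (\<forall>j\<in>J. card (violations j G') \<le> card (violations j G)) \<and>
    card {x \<in> Q. G' x \<noteq> G x} \<le> 2 * (\<Sum>i\<in>I. card (violations i G)) \<and> up_determined G'"
  using assms
proof (induction I rule: finite_induct)
  case empty
  then show ?case by (intro exI[of _ G]) auto
next
  case (insert i I)
  then obtain G' where G': "\<forall>i\<in>I. violations i G' = {}"
    "\<forall>j\<in>J. card (violations j G') \<le> card (violations j G)"
    "card {x \<in> Q. G' x \<noteq> G x} \<le> 2 * (\<Sum>i\<in>I. card (violations i G))" "up_determined G'"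
    by auto
  have i: "i \<in> J" "I \<subseteq> J" using insert.prems by auto
  let ?G = "compress i G'"
  have le: "card (violations j ?G) \<le> card (violations j G')" if "j \<in> J" for j
    by (rule card_violations_compress[OF i(1) that])
  have "violations j ?G = {}" if "j \<in> insert i I" for j
    using that le[of j] G'(1) i violations_compress_same[OF i(1)] by auto
  moreover have "card {x \<in> Q. ?G x \<noteq> G x} \<le> 2 * (\<Sum>i\<in>insert i I. card (violations i G))"
  proof -
    have "card {x \<in> Q. ?G x \<noteq> G x} \<le> card ({x \<in> Q. ?G x \<noteq> G' x} \<union> {x \<in> Q. G' x \<noteq> G x})"
      using fin by (intro card_mono) auto
    also have "\<dots> \<le> card {x \<in> Q. ?G x \<noteq> G' x} + card {x \<in> Q. G' x \<noteq> G x}" by (rule card_Un_le)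
    also have "\<dots> \<le> 2 * card (violations i G) + 2 * (\<Sum>i\<in>I. card (violations i G))"
      using card_compress_neq[OF i(1), of G'] G'(2,3) i(1) by (intro add_mono) fastforce+
    finally show ?thesis using insert.hyps by simp
  qed
  moreover have "card (violations j ?G) \<le> card (violations j G)" if "j \<in> J" for j
    using le[OF that] G'(2) that order_trans by blast
  ultimately show ?case
    using up_determined_compress[OF i(1) G'(4)] by (intro exI[of _ ?G]) simp
qed

end

subsection \<open>Two alternatives\<close>

text \<open>
  Composing with \<open>align\<close> turns left multiplication by position permutations into an action on
  rankings that never changes the relative order of \<open>a\<close> and \<open>b\<close>.
\<close>

definition align :: "nat \<Rightarrow> nat \<Rightarrow> (nat \<Rightarrow> nat) \<Rightarrow> (nat \<Rightarrow> nat) \<Rightarrow> nat \<Rightarrow> nat" where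
  "align a b p q = (if (p a < p b) = (q a < q b) then q else q \<circ> swap a b)"

lemma swap_order:
  assumes "q \<in> perms k" "a \<noteq> b"
  shows "(q \<circ> swap a b) a < (q \<circ> swap a b) b \<longleftrightarrow> \<not> q a < q b"
  using perms_inj[OF assms(1), of a b] assms(2) by auto

lemma perms_swap:
  assumes "q \<in> perms k" "a \<in> {1..k}" "b \<in> {1..k}"
  shows "q \<circ> swap a b \<in> perms k"
  using assms permutes_compose[OF permutes_swap_id[OF assms(2,3)]] unfolding perms_def by simp

lemma align_perms:
  assumes "q \<in> perms k" "a \<in> {1..k}" "b \<in> {1..k}"
  shows "align a b p q \<in> perms k"
  unfolding align_def using assms perms_swap[OF assms] by simp

lemma align_self: "align a b p p = p"
  unfolding align_def by simp

lemma comp_swap_swap: "q \<circ> swap a b \<circ> swap a b = q"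
  by (simp add: fun_eq_iff)

text \<open>Left multiplication by \<open>v\<close> commutes with the correction by
  \<open>swap a b\<close>, so successive aligned moves compose and \<open>act\<close> is a group
  action.\<close>

lemma align_comp_align:
  assumes q: "q \<in> perms k" and v: "v permutes {1..k}" and ab: "a \<noteq> b"
  shows "align a b (align a b p q) (v \<circ> align a b p q) = align a b p (v \<circ> q)"
proof (cases "(p a < p b) = (q a < q b)")
  case True
  then show ?thesis unfolding align_def by simp
next
  case False
  then have e: "align a b p q = q \<circ> swap a b" unfolding align_def by simp
  note o = swap_order[OF q ab] swap_order[OF perms_comp[OF q v] ab]
  show ?thesis
    unfolding e unfolding align_def comp_assoc[symmetric] o
    using False by (auto simp: comp_swap_swap)
qed

lemma align_swap:
  assumes p: "p \<in> perms k" and q: "q \<in> perms k" and ab: "a \<noteq> b"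
  shows "align a b (p \<circ> swap a b) (q \<circ> swap a b) = align a b p q \<circ> swap a b"
  unfolding align_def swap_order[OF p ab] swap_order[OF q ab] by auto

text \<open>A neighbour swap reverses \<open>a\<close> and \<open>b\<close> only by exchanging
  exactly these two; the correction then undoes it, so the aligned swap is trivial.\<close>

lemma adj_swap_order_changed:
  assumes p: "p \<in> perms k" and ab: "a \<noteq> b"
    and ne: "(p a < p b) \<noteq> ((adj_swap j \<circ> p) a < (adj_swap j \<circ> p) b)"
  shows "adj_swap j \<circ> p \<circ> swap a b = p"
proof -
  have pab: "p a \<noteq> p b" using perms_inj[OF p] ab by simp
  have "p a = j \<and> p b = Suc j \<or> p a = Suc j \<and> p b = j"
    using ne pab by (auto simp: Transposition.transpose_def split: if_splits)
  then have "adj_swap j = swap (p a) (p b)" by (auto simp: transpose_commute)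
  then show ?thesis
    by (simp add: fun_eq_iff Transposition.transpose_def perms_inj[OF p])
qed

lemma card_le_two_error:
  assumes "finite N" "inj_on g Q" "A \<subseteq> N \<union> {x \<in> Q. g x \<in> N}" "finite Q"
  shows "card A \<le> 2 * card N"
proof -
  have "card A \<le> card (N \<union> {x \<in> Q. g x \<in> N})" using assms by (intro card_mono) auto
  also have "\<dots> \<le> card N + card N"
    by (intro order_trans[OF card_Un_le] add_left_mono card_preimage_le assms)
  finally show ?thesis by simp
qed

section \<open>Functions that almost always elect \<open>a\<close> or \<open>b\<close>\<close>

locale near_two_valued =
  fixes n k :: nat and F :: "(nat \<Rightarrow> nat \<Rightarrow> nat) \<Rightarrow> nat" and N :: "(nat \<Rightarrow> nat \<Rightarrow> nat) set"
    and a b :: nat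
  assumes tame: "tame n k F N"
    and a: "a \<in> {1..k}" and b: "b \<in> {1..k}" and ab: "a \<noteq> b"
    and two_values: "\<And>\<sigma>. \<sigma> \<in> perm_profiles n k \<Longrightarrow> \<sigma> \<notin> N \<Longrightarrow> F \<sigma> = a \<or> F \<sigma> = b"
begin

abbreviation "Q \<equiv> perm_profiles n k"

definition act :: "nat \<Rightarrow> (nat \<Rightarrow> nat) \<Rightarrow> (nat \<Rightarrow> nat \<Rightarrow> nat) \<Rightarrow> nat \<Rightarrow> nat \<Rightarrow> nat" where
  "act i w \<sigma> = \<sigma>(i := align a b (\<sigma> i) (w \<circ> \<sigma> i))"

definition flip :: "nat \<Rightarrow> (nat \<Rightarrow> nat \<Rightarrow> nat) \<Rightarrow> nat \<Rightarrow> nat \<Rightarrow> nat" where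
  "flip i \<sigma> = \<sigma>(i := \<sigma> i \<circ> swap a b)"

lemma finite_N: "finite N"
  by (rule tame_finite[OF tame])

lemma act_in:
  assumes "\<sigma> \<in> Q" "i \<in> {1..n}" "w permutes {1..k}"
  shows "act i w \<sigma> \<in> Q"
  unfolding act_def
  using assms by (intro perm_profiles_upd align_perms perms_comp perm_profiles_nth[OF assms(1)] a b)

lemma flip_in:
  assumes "\<sigma> \<in> Q" "i \<in> {1..n}"
  shows "flip i \<sigma> \<in> Q"
  unfolding flip_def
  using assms by (intro perm_profiles_upd perms_swap perm_profiles_nth[OF assms(1)] a b)

lemma act_act:
  assumes "\<sigma> \<in> Q" "i \<in> {1..n}" "w permutes {1..k}" "v permutes {1..k}"
  shows "act i v (act i w \<sigma>) = act i (v \<circ> w) \<sigma>"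
  using align_comp_align[OF perms_comp[OF perm_profiles_nth[OF assms(1,2)] assms(3)] assms(4) ab]
  unfolding act_def by (simp add: comp_assoc)

lemma act_id: "act i id \<sigma> = \<sigma>"
  unfolding act_def by (simp add: align_self)

lemma act_flip:
  assumes "\<sigma> \<in> Q" "i \<in> {1..n}" "w permutes {1..k}"
  shows "act i w (flip i \<sigma>) = flip i (act i w \<sigma>)"
  using align_swap[OF perm_profiles_nth[OF assms(1,2)]
      perms_comp[OF perm_profiles_nth[OF assms(1,2)] assms(3)] ab]
  unfolding act_def flip_def by (simp add: comp_assoc)

lemma inj_on_act:
  assumes "i \<in> {1..n}" "w permutes {1..k}"
  shows "inj_on (act i w) Q"
proof (rule inj_on_inverseI[of _ "act i (inv w)"])
  fix \<sigma> assume "\<sigma> \<in> Q"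
  then show "act i (inv w) (act i w \<sigma>) = \<sigma>"
    using assms by (simp add: act_act permutes_inv permutes_inv_o(2) act_id)
qed

lemma flip_flip: "flip i (flip i \<sigma>) = \<sigma>"
  unfolding flip_def by (simp add: comp_swap_swap)

lemma inj_on_flip: "inj_on (flip i) A"
  by (rule inj_on_inverseI[of _ "flip i"]) (rule flip_flip)

text \<open>An aligned swap that would reverse \<open>a\<close> and \<open>b\<close> is the
  identity. For any other swap, a change would place both outcomes at the swapped positions; as both
  lie in \<open>{a, b}\<close>, the swap would have reversed \<open>a\<close> and \<open>b\<close>
  after all.\<close>

lemma act_adj_swap_preserves:
  assumes \<sigma>: "\<sigma> \<in> Q" and i: "i \<in> {1..n}" and j: "1 \<le> j" "j < k"
    and nN: "\<sigma> \<notin> N" "act i (adj_swap j) \<sigma> \<notin> N"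
  shows "F (act i (adj_swap j) \<sigma>) = F \<sigma>"
proof (cases "(\<sigma> i a < \<sigma> i b) = ((adj_swap j \<circ> \<sigma> i) a < (adj_swap j \<circ> \<sigma> i) b)")
  case False
  have "act i (adj_swap j) \<sigma> = \<sigma>"
    using adj_swap_order_changed[OF perm_profiles_nth[OF \<sigma> i] ab False] False
    unfolding act_def align_def by simp
  then show ?thesis by simp
next
  case True
  then have e: "act i (adj_swap j) \<sigma> = \<sigma>(i := adj_swap j \<circ> \<sigma> i)"
    unfolding act_def align_def by simp
  have in': "act i (adj_swap j) \<sigma> \<in> Q" using \<sigma> i j by (intro act_in adj_swap_permutes)
  show ?thesis
  proof (rule ccontr)
    assume ne: "F (act i (adj_swap j) \<sigma>) \<noteq> F \<sigma>"
    have D: "\<sigma> i (F \<sigma>) = j" "\<sigma> i (F (act i (adj_swap j) \<sigma>)) = Suc j"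
      using tameD[OF tame \<sigma> i j] nN ne unfolding e by auto
    then show False using two_values[OF \<sigma> nN(1)] two_values[OF in' nN(2)] True ne by auto
  qed
qed

lemma card_act_changed:
  assumes i: "i \<in> {1..n}" and w: "w permutes {1..k}"
  shows "card {\<sigma> \<in> Q. (F \<sigma> = a) \<noteq> (F (act i w \<sigma>) = a)} \<le> 4 * k\<^sup>2 * card N"
proof -
  define D where "D w = {\<sigma> \<in> Q. (F \<sigma> = a) \<noteq> (F (act i w \<sigma>) = a)}" for w
  have finD: "finite (D w)" for w unfolding D_def by simp
  have "card (D w) \<le> 2 * k\<^sup>2 * (2 * card N)"
  proof (rule permutation_le_adj_swaps[where l = 1 and D = "\<lambda>w. card (D w)", OF _ _ _ _ w])
    show "card (D id) = 0" unfolding D_def by (simp add: act_id)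
  next
    fix v w assume v: "v permutes {1..k}" and w: "w permutes {1..k}"
    have "D (v \<circ> w) \<subseteq> {\<sigma> \<in> Q. act i w \<sigma> \<in> D v} \<union> D w"
      unfolding D_def using act_in[OF _ i w] act_act[OF _ i w v] by auto
    then have "card (D (v \<circ> w)) \<le> card ({\<sigma> \<in> Q. act i w \<sigma> \<in> D v} \<union> D w)"
      using finD by (intro card_mono) auto
    also have "\<dots> \<le> card (D v) + card (D w)"
      by (intro order_trans[OF card_Un_le] add_right_mono card_preimage_le finD inj_on_act i w)
    finally show "card (D (v \<circ> w)) \<le> card (D v) + card (D w)" .
  next
    fix j assume j: "1 \<le> j" "j < k"
    have "D (adj_swap j) \<subseteq> N \<union> {\<sigma> \<in> Q. act i (adj_swap j) \<sigma> \<in> N}"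
    proof
      fix \<sigma> assume "\<sigma> \<in> D (adj_swap j)"
      then show "\<sigma> \<in> N \<union> {\<sigma> \<in> Q. act i (adj_swap j) \<sigma> \<in> N}"
        unfolding D_def using act_adj_swap_preserves[OF _ i j, of \<sigma>] by auto
    qed
    then show "card (D (adj_swap j)) \<le> 2 * card N"
      by (rule card_le_two_error[OF finite_N inj_on_act[OF i adj_swap_permutes[OF j]]]) simp
  qed simp
  then show ?thesis unfolding D_def by simp
qed

text \<open>Voters are moved one at a time, each at the cost in \<open>card_act_changed\<close>.
  Moving voter \<open>Suc m\<close> first lets the induction hypothesis apply to the moved
  profile.\<close>

lemma card_act_all_changed:
  assumes w: "w \<in> Q" and m: "m \<le> n"
  shows "card {\<sigma> \<in> Q. (F \<sigma> = a) \<noteq>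
      (F (\<lambda>i. if i \<in> {1..m} then align a b (\<sigma> i) (w i \<circ> \<sigma> i) else \<sigma> i) = a)} \<le> m * (4 * k\<^sup>2 * card N)"
  using m
proof (induction m)
  case 0
  then show ?case by simp
next
  case (Suc m)
  let ?V = "\<lambda>m \<sigma> i. if i \<in> {1..m} then align a b (\<sigma> i) (w i \<circ> \<sigma> i) else \<sigma> i"
  let ?D = "\<lambda>m. {\<sigma> \<in> Q. (F \<sigma> = a) \<noteq> (F (?V m \<sigma>) = a)}"
  let ?i = "Suc m"
  let ?U = "act ?i (w ?i)"
  let ?A = "{\<sigma> \<in> Q. (F \<sigma> = a) \<noteq> (F (?U \<sigma>) = a)}"
  have i: "?i \<in> {1..n}" using Suc.prems by auto
  have wi: "w ?i permutes {1..k}" using perm_profiles_nth[OF w i] by (simp add: perms_def)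
  have e: "?V (Suc m) \<sigma> = ?V m (?U \<sigma>)" for \<sigma>
    by (rule ext) (auto simp: act_def)
  have "?D (Suc m) \<subseteq> ?A \<union> {\<sigma> \<in> Q. ?U \<sigma> \<in> ?D m}"
    unfolding e using act_in[OF _ i wi] by auto
  then have "card (?D (Suc m)) \<le> card (?A \<union> {\<sigma> \<in> Q. ?U \<sigma> \<in> ?D m})"
    by (intro card_mono) auto
  also have "\<dots> \<le> card ?A + card {\<sigma> \<in> Q. ?U \<sigma> \<in> ?D m}" by (rule card_Un_le)
  also have "\<dots> \<le> 4 * k\<^sup>2 * card N + card (?D m)"
    by (intro add_mono card_act_changed i wi card_preimage_le inj_on_act) simp
  also have "\<dots> \<le> 4 * k\<^sup>2 * card N + m * (4 * k\<^sup>2 * card N)"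
    using Suc.IH Suc.prems by (intro add_left_mono) simp
  finally show ?case by simp
qed

text \<open>\<open>\<rho>\<close> is kept except that \<open>a\<close> and \<open>b\<close> are
  exchanged where needed to agree with \<open>\<sigma>\<close>; the result depends on
  \<open>\<sigma>\<close> only through its comparisons of \<open>a\<close> and
  \<open>b\<close>.\<close>

definition based :: "(nat \<Rightarrow> nat \<Rightarrow> nat) \<Rightarrow> (nat \<Rightarrow> nat \<Rightarrow> nat) \<Rightarrow> nat \<Rightarrow> nat \<Rightarrow> nat" where
  "based \<rho> \<sigma> = (\<lambda>i\<in>{1..n}. align a b (\<sigma> i) (\<rho> i))"

text \<open>
  Substituting \<open>\<rho> i = w i \<circ> \<sigma> i\<close> turns the base profile into the image of \<open>\<sigma>\<close> under the action of \<open>w\<close>,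
  so an average over \<open>\<rho>\<close> is an average over \<open>w\<close>.
\<close>

lemma exists_base:
  obtains \<rho> where
    "card {\<sigma> \<in> Q. (F \<sigma> = a) \<noteq> (F (based \<rho> \<sigma>) = a)} \<le> n * (4 * k\<^sup>2 * card N)"
proof -
  let ?K = "n * (4 * k\<^sup>2 * card N)"
  let ?E = "\<lambda>\<rho>. {\<sigma> \<in> Q. (F \<sigma> = a) \<noteq> (F (based \<rho> \<sigma>) = a)}"
  let ?V = "\<lambda>w \<sigma> i. if i \<in> {1..n} then align a b (\<sigma> i) (w i \<circ> \<sigma> i) else \<sigma> i"
  let ?D = "\<lambda>w. {\<sigma> \<in> Q. (F \<sigma> = a) \<noteq> (F (?V w \<sigma>) = a)}"
  have "Sigma Q ?E \<subseteq> (\<Union>w\<in>Q. (\<lambda>\<sigma>. (\<lambda>i\<in>{1..n}. w i \<circ> \<sigma> i, \<sigma>)) ` ?D w)"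
  proof
    fix z assume "z \<in> Sigma Q ?E"
    then obtain \<rho> \<sigma> where z: "z = (\<rho>, \<sigma>)" and \<rho>: "\<rho> \<in> Q" and \<sigma>: "\<sigma> \<in> ?E \<rho>" by blast
    let ?w = "\<lambda>i\<in>{1..n}. \<rho> i \<circ> inv (\<sigma> i)"
    have p: "\<sigma> i permutes {1..k}" "\<rho> i permutes {1..k}" if "i \<in> {1..n}" for i
      using that \<sigma> \<rho> perm_profiles_nth by (auto simp: perms_def)
    have w: "?w \<in> Q"
      unfolding perm_profiles_def perms_def using p permutes_inv
      by (intro restrict_PiE_iff[THEN iffD2] ballI CollectI permutes_compose) auto
    have wc: "?w i \<circ> \<sigma> i = \<rho> i" if "i \<in> {1..n}" for i
      using that permutes_inv_o(2)[OF p(1)[OF that]] by (simp add: comp_assoc)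
    \<comment> \<open>Profiles are extensional: outside \<open>{1..n}\<close>, where
      \<open>?V\<close> returns \<open>\<sigma> i\<close>, both sides are
      \<open>undefined\<close>.\<close>
    have undef: "\<sigma> i = undefined" "\<rho> i = undefined" if "i \<notin> {1..n}" for i
      using that \<sigma> \<rho> unfolding perm_profiles_def by auto
    have "?V ?w \<sigma> = based \<rho> \<sigma>"
    proof
      show "?V ?w \<sigma> i = based \<rho> \<sigma> i" for i
        using wc[of i] undef[of i] unfolding based_def
        by (cases "i \<in> {1..n}") (simp_all del: atLeastAtMost_iff)
    qed
    then have "\<sigma> \<in> ?D ?w" using \<sigma> by simp
    moreover have "(\<lambda>i\<in>{1..n}. ?w i \<circ> \<sigma> i) = \<rho>"
    proof
      show "(\<lambda>i\<in>{1..n}. ?w i \<circ> \<sigma> i) i = \<rho> i" for i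
        using wc[of i] undef[of i] by (cases "i \<in> {1..n}") (simp_all del: atLeastAtMost_iff)
    qed
    ultimately show "z \<in> (\<Union>w\<in>Q. (\<lambda>\<sigma>. (\<lambda>i\<in>{1..n}. w i \<circ> \<sigma> i, \<sigma>)) ` ?D w)"
      unfolding z by (intro UN_I[OF w] image_eqI[of _ _ \<sigma>]) auto
  qed
  then have "card (Sigma Q ?E) \<le> card (\<Union>w\<in>Q. (\<lambda>\<sigma>. (\<lambda>i\<in>{1..n}. w i \<circ> \<sigma> i, \<sigma>)) ` ?D w)"
    by (intro card_mono) auto
  also have "\<dots> \<le> (\<Sum>w\<in>Q. card ((\<lambda>\<sigma>. (\<lambda>i\<in>{1..n}. w i \<circ> \<sigma> i, \<sigma>)) ` ?D w))"
    by (rule card_UN_le) simp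
  also have "\<dots> \<le> (\<Sum>w\<in>Q. ?K)"
    by (intro sum_mono order_trans[OF card_image_le card_act_all_changed]) simp_all
  finally have "(\<Sum>\<rho>\<in>Q. card (?E \<rho>)) \<le> (\<Sum>w\<in>Q. ?K)" by simp
  then have "\<not> (\<forall>\<rho>\<in>Q. ?K < card (?E \<rho>))"
    using sum_strict_mono[of Q "\<lambda>_. ?K" "\<lambda>\<rho>. card (?E \<rho>)"] perm_profiles_nonempty by fastforce
  then show ?thesis using that by (auto simp: not_less)
qed

text \<open>With \<open>b\<close> at position \<open>r\<close> and \<open>a\<close> at position
  \<open>s\<close> below it, an aligned move that commutes with the flip brings \<open>a\<close> to
  \<open>Suc r\<close>. The flip then is a neighbour swap raising \<open>a\<close>, to which a tame
  function does not respond by dropping \<open>a\<close> outside \<open>N\<close>. The bound sums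
  over all pairs of positions.\<close>

lemma card_flip_violations:
  assumes i: "i \<in> {1..n}"
  shows "card {\<sigma> \<in> Q. \<sigma> i b < \<sigma> i a \<and> F \<sigma> = a \<and> F (flip i \<sigma>) \<noteq> a} \<le> 10 * k ^ 4 * card N"
proof -
  let ?S = "{\<sigma> \<in> Q. \<sigma> i b < \<sigma> i a \<and> F \<sigma> = a \<and> F (flip i \<sigma>) \<noteq> a}"
  let ?P = "{1..k} \<times> {1..k}"
  let ?V = "\<lambda>(r, s). {\<sigma> \<in> ?S. \<sigma> i b = r \<and> \<sigma> i a = s}"
  have V: "card (?V (r, s)) \<le> (8 * k\<^sup>2 + 2) * card N" if r: "r \<in> {1..k}" and s: "s \<in> {1..k}" for r s
  proof (cases "r < s")
    case False
    then have "?V (r, s) = {}" by auto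
    then show ?thesis by (simp only: card.empty)
  next
    case True
    let ?w = "swap (Suc r) s"
    let ?A = "{\<sigma> \<in> Q. (F \<sigma> = a) \<noteq> (F (act i ?w \<sigma>) = a)}"
    let ?B = "{\<sigma> \<in> Q. flip i \<sigma> \<in> ?A}"
    let ?C = "N \<union> {\<sigma> \<in> Q. flip i \<sigma> \<in> N}"
    let ?D = "{\<sigma> \<in> Q. act i ?w \<sigma> \<in> ?C}"
    have w: "?w permutes {1..k}" using True r s by (intro permutes_swap_id) auto
    have "?V (r, s) \<subseteq> ?A \<union> (?B \<union> ?D)"
    proof (rule subsetI, rule ccontr)
      fix \<sigma> assume \<sigma>: "\<sigma> \<in> ?V (r, s)" and n: "\<sigma> \<notin> ?A \<union> (?B \<union> ?D)"
      then have Q: "\<sigma> \<in> Q" and pos: "\<sigma> i b = r" "\<sigma> i a = s" by auto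
      let ?\<tau> = "act i ?w \<sigma>"
      have \<tau>Q: "?\<tau> \<in> Q" "flip i ?\<tau> \<in> Q" "flip i \<sigma> \<in> Q"
        using Q i w by (auto intro!: act_in flip_in)
      have F: "F ?\<tau> = a" "F (flip i ?\<tau>) \<noteq> a" "?\<tau> \<notin> N" "flip i ?\<tau> \<notin> N"
        using \<sigma> n \<tau>Q act_flip[OF Q i w] by auto
      \<comment> \<open>\<open>r\<close> is neither \<open>Suc r\<close> nor \<open>s\<close>, so
        \<open>b\<close> stays above \<open>a\<close> and no correction is applied.\<close>
      have "?\<tau> i = ?w \<circ> \<sigma> i"
        unfolding act_def align_def using pos True by (auto simp: Transposition.transpose_def)
      then have p\<tau>: "?\<tau> i b = r" "?\<tau> i a = Suc r"
        using pos True by (auto simp: Transposition.transpose_def)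
      have "flip i ?\<tau> = ?\<tau>(i := adj_swap r \<circ> ?\<tau> i)"
        unfolding flip_def comp_swap[OF perm_profiles_nth[OF \<tau>Q(1) i]] p\<tau>
        by (simp add: transpose_commute)
      \<comment> \<open>A change at this swap would put the outcome \<open>a\<close> at the upper
        position \<open>r\<close>, but \<open>a\<close> is at \<open>Suc r\<close>.\<close>
      then show False
        using tameD(1)[OF tame \<tau>Q(1) i, of r] F p\<tau> r s True by auto
    qed
    then have "card (?V (r, s)) \<le> card (?A \<union> (?B \<union> ?D))"
      using finite_N by (intro card_mono) auto
    also have "\<dots> \<le> card ?A + (card ?B + card ?D)"
      by (intro order_trans[OF card_Un_le] add_left_mono card_Un_le)
    \<comment> \<open>The event may change along the move from the profile or from its flip, or an
      end of the neighbour swap lies in the error set.\<close>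
    also have "\<dots> \<le> 4 * k\<^sup>2 * card N + (4 * k\<^sup>2 * card N + 2 * card N)"
    proof (intro add_mono)
      show A: "card ?A \<le> 4 * k\<^sup>2 * card N" by (rule card_act_changed[OF i w])
      have "card ?B \<le> card ?A" by (rule card_preimage_le[OF _ inj_on_flip]) simp
      then show "card ?B \<le> 4 * k\<^sup>2 * card N" using A by linarith
      have "card ?D \<le> card ?C" 
        using finite_N by (intro card_preimage_le inj_on_act[OF i w]) auto
      also have "\<dots> \<le> 2 * card N" by (rule card_le_two_error[OF finite_N inj_on_flip]) auto
      finally show "card ?D \<le> 2 * card N" .
    qed
    finally show ?thesis by (simp add: algebra_simps)
  qed
  have "?S \<subseteq> (\<Union>rs\<in>?P. ?V rs)"
  proof
    fix \<sigma> assume \<sigma>: "\<sigma> \<in> ?S"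
    then have "\<sigma> i \<in> perms k" using i perm_profiles_nth by blast
    then have "\<sigma> i b \<in> {1..k}" "\<sigma> i a \<in> {1..k}" using a b by (simp_all only: perms_in)
    then show "\<sigma> \<in> (\<Union>rs\<in>?P. ?V rs)" using \<sigma> by (intro UN_I[of "(\<sigma> i b, \<sigma> i a)"]) auto
  qed
  then have "card ?S \<le> card (\<Union>rs\<in>?P. ?V rs)" by (intro card_mono) auto
  also have "\<dots> \<le> (\<Sum>rs\<in>?P. card (?V rs))" by (rule card_UN_le) simp
  also have "\<dots> \<le> (\<Sum>rs\<in>?P. (8 * k\<^sup>2 + 2) * card N)" using V by (intro sum_mono) blast
  also have "\<dots> = k\<^sup>2 * (8 * k\<^sup>2 + 2) * card N"
    by (simp add: card_cartesian_product power2_eq_square algebra_simps)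
  also have "\<dots> \<le> 10 * k ^ 4 * card N"
  proof (rule mult_right_mono)
    have "k\<^sup>2 \<le> k ^ 4" using a by (intro power_increasing) auto
    moreover have "k\<^sup>2 * (8 * k\<^sup>2 + 2) = 8 * k ^ 4 + 2 * k\<^sup>2" by (simp add: power_numeral_reduce algebra_simps)
    ultimately show "k\<^sup>2 * (8 * k\<^sup>2 + 2) \<le> 10 * k ^ 4" by linarith
  qed simp
  finally show ?thesis .
qed

text \<open>Fixing a base profile replaces the event that \<open>a\<close> wins by one depending
  only on who prefers \<open>a\<close> to \<open>b\<close>. Its violations come from errors of the
  base or from flip violations of \<open>F\<close>, and compression removes them.\<close>

lemma near_monotone:
  obtains G where
    "\<And>\<sigma> \<tau>. \<sigma> \<in> Q \<Longrightarrow> \<tau> \<in> Q \<Longrightarrow> (\<forall>i\<in>{1..n}. (\<sigma> i a < \<sigma> i b) = (\<tau> i a < \<tau> i b)) \<Longrightarrow> G \<sigma> = G \<tau>"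
    "\<And>i \<sigma>. i \<in> {1..n} \<Longrightarrow> \<sigma> \<in> Q \<Longrightarrow> \<not> \<sigma> i a < \<sigma> i b \<Longrightarrow> G \<sigma> \<Longrightarrow> G (flip i \<sigma>)"
    "card {\<sigma> \<in> Q. (F \<sigma> = a) \<noteq> G \<sigma>} \<le> 40 * n\<^sup>2 * k ^ 4 * card N"
proof -
  let ?up = "\<lambda>i \<sigma>. \<sigma> i a < (\<sigma> i b :: nat)"
  interpret cube: flip_cube Q "{1..n}" flip ?up
  proof
    fix i j \<sigma> assume i: "i \<in> {1..n}" and j: "j \<in> {1..n}" and \<sigma>: "\<sigma> \<in> Q"
    show "flip i (flip j \<sigma>) = flip j (flip i \<sigma>)"
      unfolding flip_def by (cases "i = j") (auto simp: fun_upd_twist)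
    show "?up j (flip i \<sigma>) \<longleftrightarrow> (?up j \<sigma> \<noteq> (i = j))"
      using swap_order[OF perm_profiles_nth[OF \<sigma> i] ab] unfolding flip_def by auto
  qed (simp_all add: flip_in flip_flip)
  obtain \<rho> where c\<rho>: "card {\<sigma> \<in> Q. (F \<sigma> = a) \<noteq> (F (based \<rho> \<sigma>) = a)} \<le> n * (4 * k\<^sup>2 * card N)"
    by (rule exists_base)
  define G0 where "G0 \<sigma> \<longleftrightarrow> F (based \<rho> \<sigma>) = a" for \<sigma>
  let ?E = "{\<sigma> \<in> Q. (F \<sigma> = a) \<noteq> G0 \<sigma>}"
  let ?X = "n * k ^ 4 * card N"
  have cE: "card ?E \<le> 4 * ?X"
  proof -
    have "k\<^sup>2 \<le> k ^ 4" using a by (intro power_increasing) auto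
    then have "n * (4 * k\<^sup>2 * card N) \<le> n * (4 * k ^ 4 * card N)"
      by (intro mult_right_mono mult_left_mono) auto
    also have "\<dots> = 4 * ?X" by simp
    finally show ?thesis using c\<rho> unfolding G0_def by (rule order_trans[rotated])
  qed
  have det: "cube.up_determined G0"
    unfolding cube.up_determined_def
  proof (intro ballI impI)
    fix \<sigma> \<tau> assume "\<forall>i\<in>{1..n}. ?up i \<sigma> = ?up i \<tau>"
    then have "based \<rho> \<sigma> = based \<rho> \<tau>" unfolding based_def align_def by (intro restrict_ext) simp
    then show "G0 \<sigma> = G0 \<tau>" unfolding G0_def by simp
  qed
  \<comment> \<open>18 is \<open>4 + 4 + 10\<close>: the base may err at either end of the edge, or
    the violation is one of \<open>F\<close>.\<close>
  have viol: "card (cube.violations i G0) \<le> 18 * ?X" if i: "i \<in> {1..n}" for i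
  proof -
    let ?S = "{\<sigma> \<in> Q. \<sigma> i b < \<sigma> i a \<and> F \<sigma> = a \<and> F (flip i \<sigma>) \<noteq> a}"
    have "cube.violations i G0 \<subseteq> ?E \<union> ({\<sigma> \<in> Q. flip i \<sigma> \<in> ?E} \<union> ?S)"
    proof
      fix \<sigma> assume \<sigma>: "\<sigma> \<in> cube.violations i G0"
      then have "\<sigma> \<in> Q" unfolding cube.violations_def by simp
      then have "\<sigma> i a \<noteq> \<sigma> i b" using perms_inj[OF perm_profiles_nth[OF \<open>\<sigma> \<in> Q\<close> i], of a b] ab by simp
      then show "\<sigma> \<in> ?E \<union> ({\<sigma> \<in> Q. flip i \<sigma> \<in> ?E} \<union> ?S)"
        using \<sigma> flip_in[OF _ i] unfolding cube.violations_def by auto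
    qed
    then have "card (cube.violations i G0) \<le> card (?E \<union> ({\<sigma> \<in> Q. flip i \<sigma> \<in> ?E} \<union> ?S))"
      by (intro card_mono) auto
    also have "\<dots> \<le> card ?E + (card {\<sigma> \<in> Q. flip i \<sigma> \<in> ?E} + card ?S)"
      by (intro order_trans[OF card_Un_le] add_left_mono card_Un_le)
    also have "\<dots> \<le> card ?E + (card ?E + 10 * k ^ 4 * card N)"
      by (intro add_mono card_preimage_le[OF _ inj_on_flip] card_flip_violations[OF i]) simp_all
    also have "10 * k ^ 4 * card N \<le> 10 * ?X" using i by simp
    finally show ?thesis using cE by linarith
  qed
  obtain G where G: "\<forall>i\<in>{1..n}. cube.violations i G = {}" "cube.up_determined G"
    and cG: "card {\<sigma> \<in> Q. G \<sigma> \<noteq> G0 \<sigma>} \<le> 2 * (\<Sum>i\<in>{1..n}. card (cube.violations i G0))"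
    using cube.monotonize[OF _ order.refl det] by auto
  have "{\<sigma> \<in> Q. (F \<sigma> = a) \<noteq> G \<sigma>} \<subseteq> ?E \<union> {\<sigma> \<in> Q. G \<sigma> \<noteq> G0 \<sigma>}" by auto
  then have "card {\<sigma> \<in> Q. (F \<sigma> = a) \<noteq> G \<sigma>} \<le> card (?E \<union> {\<sigma> \<in> Q. G \<sigma> \<noteq> G0 \<sigma>})"
    by (intro card_mono) auto
  also have "\<dots> \<le> card ?E + card {\<sigma> \<in> Q. G \<sigma> \<noteq> G0 \<sigma>}" by (rule card_Un_le)
  \<comment> \<open>\<open>4 * ?X\<close> pays for the base, and twice \<open>18 * ?X\<close> for
    each compressed direction.\<close>
  also have "\<dots> \<le> 4 * ?X + 2 * (\<Sum>i\<in>{1..n}. 18 * ?X)"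
    by (intro add_mono cE order_trans[OF cG] mult_left_mono sum_mono viol) simp_all
  also have "\<dots> = 4 * ?X + 36 * (n * ?X)" by simp
  also have "\<dots> \<le> 4 * (n * ?X) + 36 * (n * ?X)" by simp
  also have "\<dots> = 40 * n\<^sup>2 * k ^ 4 * card N" by (simp add: power2_eq_square)
  finally have "card {\<sigma> \<in> Q. (F \<sigma> = a) \<noteq> G \<sigma>} \<le> 40 * n\<^sup>2 * k ^ 4 * card N" .
  with G show ?thesis
    unfolding cube.up_determined_def cube.violations_def by (intro that[of G]) blast+
qed

end

subsection \<open>Rankings as position maps\<close>

definition rank_of :: "nat \<Rightarrow> (nat \<Rightarrow> nat) \<Rightarrow> nat rel" where
  "rank_of k p = {(x, y). x \<in> {1..k} \<and> y \<in> {1..k} \<and> p y \<le> p x}"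

lemma position_rank_of:
  assumes p: "p \<in> perms k" and x: "x \<in> {1..k}"
  shows "position (rank_of k p) x = p x"
proof -
  have pp: "p permutes {1..k}" using p by (simp add: perms_def)
  have px: "p x \<in> {1..k}" using perms_in[OF p] x by blast
  have "p ` {y \<in> {1..k}. p y \<le> p x} = {1..p x}"
  proof
    show "p ` {y \<in> {1..k}. p y \<le> p x} \<subseteq> {1..p x}"
      using perms_in[OF p] by fastforce
    show "{1..p x} \<subseteq> p ` {y \<in> {1..k}. p y \<le> p x}"
    proof
      fix z assume z: "z \<in> {1..p x}"
      then have "z \<in> p ` {1..k}" using permutes_image[OF pp] px by auto
      then show "z \<in> p ` {y \<in> {1..k}. p y \<le> p x}" using z by auto
    qed
  qed
  moreover have "inj_on p {y \<in> {1..k}. p y \<le> p x}"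
    by (rule inj_onI) (simp add: perms_inj[OF p])
  ultimately have "card {y \<in> {1..k}. p y \<le> p x} = p x"
    using card_image[of p "{y \<in> {1..k}. p y \<le> p x}"] by simp
  moreover have "{y. (x, y) \<in> rank_of k p} = {y \<in> {1..k}. p y \<le> p x}"
    using x unfolding rank_of_def by auto
  ultimately show ?thesis unfolding position_def by simp
qed

lemma rank_of_in_rankings:
  assumes "p \<in> perms k"
  shows "rank_of k p \<in> rankings k"
  using perms_inj[OF assms]
  unfolding rankings_def rank_of_def linear_order_on_def partial_order_on_def preorder_on_def
    refl_on_def trans_def antisym_def total_on_def
  by fastforce

lemma inj_on_rank_of: "inj_on (rank_of k) (perms k)"
proof (rule inj_onI)
  fix p q assume p: "p \<in> perms k" and q: "q \<in> perms k" and e: "rank_of k p = rank_of k q"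
  show "p = q"
  proof
    fix x show "p x = q x"
    proof (cases "x \<in> {1..k}")
      case True
      then show ?thesis using position_rank_of[OF p] position_rank_of[OF q] e by metis
    next
      case False
      then show ?thesis using p q unfolding perms_def by (simp add: permutes_not_in)
    qed
  qed
qed

text \<open>Counting the alternatives weakly above recovers a position map from any linear order:
  upper sets shrink strictly on moving up, so distinct alternatives have distinct positions.\<close>

lemma rankings_eq: "rank_of k ` perms k = rankings k"
proof
  show "rank_of k ` perms k \<subseteq> rankings k" by (rule image_subsetI) (rule rank_of_in_rankings)
  show "rankings k \<subseteq> rank_of k ` perms k"
  proof
    fix R assume "R \<in> rankings k"
    then have lin: "linear_order_on {1..k} R" by (simp add: rankings_def)
    then have sub: "R \<subseteq> {1..k} \<times> {1..k}" and refl: "\<And>x. x \<in> {1..k} \<Longrightarrow> (x, x) \<in> R"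
      and tr: "trans R" and anti: "antisym R" and tot: "total_on {1..k} R"
      unfolding linear_order_on_def partial_order_on_def preorder_on_def refl_on_def by auto
    let ?U = "\<lambda>x. {y. (x, y) \<in> R}"
    \<comment> \<open>\<open>permutes\<close> demands the identity outside
      \<open>{1..k}\<close>.\<close>
    define p where "p x = (if x \<in> {1..k} then position R x else x)" for x
    have U: "?U x \<subseteq> {1..k}" for x using sub by auto
    have less: "position R y < position R x" if "(x, y) \<in> R" "x \<noteq> y" for x y
      unfolding position_def
    proof (rule psubset_card_mono)
      show "finite (?U x)" by (rule finite_subset[OF U]) simp
      have "x \<in> ?U x" using that sub refl by auto
      moreover have "x \<notin> ?U y" using that anti by (auto dest: antisymD)
      moreover have "?U y \<subseteq> ?U x" using that tr by (auto dest: transD)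
      ultimately show "?U y \<subset> ?U x" by blast
    qed
    have inj: "inj_on p {1..k}"
    proof (rule inj_onI)
      fix x y assume xy: "x \<in> {1..k}" "y \<in> {1..k}" "p x = p y"
      show "x = y"
      proof (rule ccontr)
        assume "x \<noteq> y"
        then have "(x, y) \<in> R \<or> (y, x) \<in> R" using xy tot by (auto simp: total_on_def)
        then show False using less[of x y] less[of y x] xy \<open>x \<noteq> y\<close> unfolding p_def by auto
      qed
    qed
    have "p x \<in> {1..k}" if "x \<in> {1..k}" for x
    proof -
      have "card (?U x) \<le> card {1..k}" by (rule card_mono[OF _ U]) simp
      moreover have "card (?U x) > 0"
        using refl[OF that] finite_subset[OF U] by (auto simp: card_gt_0_iff)
      ultimately show ?thesis using that unfolding p_def position_def by simp
    qed
    then have "p ` {1..k} = {1..k}" using inj by (intro endo_inj_surj) auto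
    then have "p permutes {1..k}"
      using inj by (intro bij_imp_permutes) (auto simp: bij_betw_def p_def)
    then have "p \<in> perms k" by (simp add: perms_def)
    moreover have "R = rank_of k p"
    proof -
      have "(x, y) \<in> R \<longleftrightarrow> p y \<le> p x" if xy: "x \<in> {1..k}" "y \<in> {1..k}" for x y
      proof (cases "x = y")
        case True
        then show ?thesis using refl xy by simp
      next
        case False
        then have "(x, y) \<in> R \<or> (y, x) \<in> R" using xy tot by (auto simp: total_on_def)
        then show ?thesis
          using less[of x y] less[of y x] False xy anti unfolding p_def by (auto dest: antisymD)
      qed
      then show ?thesis using sub unfolding rank_of_def by auto
    qed
    ultimately show "R \<in> rank_of k ` perms k" by blast
  qed
qed

lemma prefers_rank_of:
  assumes "p \<in> perms k" "x \<in> {1..k}" "y \<in> {1..k}"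
  shows "prefers (rank_of k p) x y \<longleftrightarrow> p x < p y"
  using assms perms_inj[OF assms(1), of x y] unfolding prefers_def rank_of_def by auto

lemma top_of_rank_of:
  assumes "p \<in> perms k" "H \<subseteq> {1..k}" "x \<in> H" "\<And>y. y \<in> H \<Longrightarrow> p x \<le> p y"
  shows "top_of H (rank_of k p) = x"
  unfolding top_of_def
proof (rule the_equality)
  show "x \<in> H \<and> (\<forall>y\<in>H. (y, x) \<in> rank_of k p)"
    using assms unfolding rank_of_def by auto
  fix z assume "z \<in> H \<and> (\<forall>y\<in>H. (y, z) \<in> rank_of k p)"
  then have "p z = p x" using assms(3) assms(4)[of z] unfolding rank_of_def by force
  then show "z = x" using perms_inj[OF assms(1)] by blast
qed

lemma top_of_in:
  assumes "R \<in> rankings k" "H \<noteq> {}" "H \<subseteq> {1..k}"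
  shows "top_of H R \<in> H"
proof -
  obtain p where p: "p \<in> perms k" "R = rank_of k p"
    using assms(1) unfolding rankings_eq[symmetric] by (rule imageE)
  obtain h where "h \<in> H" using assms(2) by auto
  then obtain x where "x \<in> H" "\<And>y. y \<in> H \<Longrightarrow> p x \<le> p y"
    using ex_has_least_nat[of "\<lambda>y. y \<in> H" h p] by auto
  then show ?thesis using top_of_rank_of[OF p(1) assms(3)] p(2) by simp
qed

text \<open>This identifies right multiplication by a swap with the relabelling by
  \<open>map_prod\<close> used in \<open>adjacent_permutation\<close>.\<close>

lemma rank_of_comp_swap:
  assumes "x \<in> {1..k}" "y \<in> {1..k}"
  shows "rank_of k (p \<circ> swap x y) = map_prod (swap x y) (swap x y) ` rank_of k p"
proof -
  let ?s = "swap x y"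
  have s: "?s z \<in> {1..k} \<longleftrightarrow> z \<in> {1..k}" for z
    by (rule permutes_in_image[OF permutes_swap_id[OF assms]])
  have inj: "inj (map_prod ?s ?s)"
    by (rule inj_on_inverseI[of _ "map_prod ?s ?s"]) (simp add: prod.map_comp prod.map_id)
  show ?thesis
  proof (rule set_eqI)
    fix z :: "nat \<times> nat"
    obtain u v where z': "z = (u, v)" by (rule prod.exhaust)
    have z: "z = map_prod ?s ?s (?s u, ?s v)" unfolding z' by simp
    have "z \<in> map_prod ?s ?s ` rank_of k p \<longleftrightarrow> (?s u, ?s v) \<in> rank_of k p"
      unfolding z by (rule inj_image_mem_iff[OF inj])
    also have "\<dots> \<longleftrightarrow> z \<in> rank_of k (p \<circ> ?s)"
      unfolding z' rank_of_def using s[of u] s[of v] by (simp del: atLeastAtMost_iff)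
    finally show "z \<in> rank_of k (p \<circ> ?s) \<longleftrightarrow> z \<in> map_prod ?s ?s ` rank_of k p" ..
  qed
qed

text \<open>The swap permutes just the two alternatives found at positions \<open>j\<close> and
  \<open>Suc j\<close>, within the limit of three.\<close>

lemma adjacent_permutation_adj_swap:
  assumes p: "p \<in> perms k" and j: "1 \<le> j" "j < k"
  shows "adjacent_permutation k 3 (rank_of k p) (rank_of k (adj_swap j \<circ> p))"
proof -
  have pp: "p permutes {1..k}" using p by (simp add: perms_def)
  define x y where "x = inv p j" and "y = inv p (Suc j)"
  have pxy: "p x = j" "p y = Suc j" unfolding x_def y_def using permutes_inverses(1)[OF pp] by auto
  have xy: "x \<in> {1..k}" "y \<in> {1..k}"
    using perms_in[OF p, of x] perms_in[OF p, of y] pxy j by auto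
  have e: "adj_swap j \<circ> p = p \<circ> swap x y" unfolding comp_swap[OF p] pxy ..
  have "position (rank_of k p) ` {x, y} = {j..Suc j}"
    using pxy position_rank_of[OF p xy(1)] position_rank_of[OF p xy(2)] by auto
  then have "\<exists>l m. position (rank_of k p) ` {x, y} = {l..m}" by (intro exI)
  moreover have "card {x, y} \<le> 3" by (simp add: card_insert_if)
  moreover have "swap x y permutes {x, y}" by (intro permutes_swap_id) auto
  ultimately show ?thesis
    unfolding adjacent_permutation_def e rank_of_comp_swap[OF xy] using xy
    by (intro exI[of _ "{x, y}"] exI[of _ "swap x y"] conjI) simp_all
qed

section \<open>Profiles and probabilities in terms of position maps\<close>

definition profile_of :: "nat \<Rightarrow> nat \<Rightarrow> (nat \<Rightarrow> nat \<Rightarrow> nat) \<Rightarrow> nat \<Rightarrow> nat rel" where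
  "profile_of n k \<sigma> = (\<lambda>i\<in>{1..n}. rank_of k (\<sigma> i))"

lemma profile_of_nth: "i \<in> {1..n} \<Longrightarrow> profile_of n k \<sigma> i = rank_of k (\<sigma> i)"
  unfolding profile_of_def by simp

lemma bij_profile_of: "bij_betw (profile_of n k) (perm_profiles n k) (profiles n k)"
proof (rule bij_betw_imageI)
  show "inj_on (profile_of n k) (perm_profiles n k)"
  proof (rule inj_onI)
    fix \<sigma> \<tau> assume \<sigma>: "\<sigma> \<in> perm_profiles n k" and \<tau>: "\<tau> \<in> perm_profiles n k"
      and e: "profile_of n k \<sigma> = profile_of n k \<tau>"
    have "\<sigma> i = \<tau> i" if i: "i \<in> {1..n}" for i
      using fun_cong[OF e, of i] unfolding profile_of_nth[OF i]
      by (rule inj_onD[OF inj_on_rank_of])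
        (rule perm_profiles_nth[OF \<sigma> i] perm_profiles_nth[OF \<tau> i])+
    then show "\<sigma> = \<tau>"
      by (rule PiE_ext[OF \<sigma>[unfolded perm_profiles_def] \<tau>[unfolded perm_profiles_def]])
  qed
  show "profile_of n k ` perm_profiles n k = profiles n k"
  proof
    show "profile_of n k ` perm_profiles n k \<subseteq> profiles n k"
      unfolding profile_of_def profiles_def
      by (intro image_subsetI restrict_PiE_iff[THEN iffD2] ballI rank_of_in_rankings)
        (rule perm_profiles_nth)
    show "profiles n k \<subseteq> profile_of n k ` perm_profiles n k"
    proof
      fix \<pi> assume \<pi>: "\<pi> \<in> profiles n k"
      let ?\<sigma> = "\<lambda>i\<in>{1..n}. inv_into (perms k) (rank_of k) (\<pi> i)"
      have r: "\<pi> i \<in> rank_of k ` perms k" if "i \<in> {1..n}" for i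
        using \<pi> that unfolding profiles_def rankings_eq by (rule PiE_mem)
      have "?\<sigma> \<in> perm_profiles n k"
        unfolding perm_profiles_def restrict_PiE_iff by (intro ballI inv_into_into r)
      moreover have "profile_of n k ?\<sigma> = \<pi>"
      proof
        fix i show "profile_of n k ?\<sigma> i = \<pi> i"
        proof (cases "i \<in> {1..n}")
          case True
          then show ?thesis using f_inv_into_f[OF r[OF True]] by (simp add: profile_of_def)
        next
          case False
          then show ?thesis using PiE_arb[OF \<pi>[unfolded profiles_def] False]
            unfolding profile_of_def by (simp only: restrict_def if_False)
        qed
      qed
      ultimately show "\<pi> \<in> profile_of n k ` perm_profiles n k"
        by (intro image_eqI[of _ _ ?\<sigma>]) simp_all
    qed
  qed
qed

lemma profile_of_in: "\<sigma> \<in> perm_profiles n k \<Longrightarrow> profile_of n k \<sigma> \<in> profiles n k"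
  by (rule bij_betw_apply[OF bij_profile_of])

lemma profiles_eq: "profile_of n k ` perm_profiles n k = profiles n k"
  by (rule bij_betw_imp_surj_on[OF bij_profile_of])

lemma finite_profiles: "finite (profiles n k)"
  unfolding profiles_eq[symmetric] by simp

lemma prob_profile_eq:
  "prob_profile n k A
    = real (card {\<sigma> \<in> perm_profiles n k. profile_of n k \<sigma> \<in> A}) / real (card (perm_profiles n k))"
proof -
  have ne: "profiles n k \<noteq> {}" unfolding profiles_eq[symmetric] using perm_profiles_nonempty by simp
  have "profiles n k \<inter> A = profile_of n k ` {\<sigma> \<in> perm_profiles n k. profile_of n k \<sigma> \<in> A}"
    unfolding profiles_eq[symmetric] by auto
  moreover have "inj_on (profile_of n k) {\<sigma> \<in> perm_profiles n k. profile_of n k \<sigma> \<in> A}"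
    using bij_betw_imp_inj_on[OF bij_profile_of] by (rule inj_on_subset) auto
  ultimately have "card (profiles n k \<inter> A) = card {\<sigma> \<in> perm_profiles n k. profile_of n k \<sigma> \<in> A}"
    by (simp add: card_image)
  then show ?thesis
    unfolding prob_profile_def measure_pmf_of_set[OF ne finite_profiles]
    using bij_betw_same_card[OF bij_profile_of, of n k] by simp
qed

lemma distance_eq:
  "distance n k f g = real (card {\<sigma> \<in> perm_profiles n k. f (profile_of n k \<sigma>) \<noteq> g (profile_of n k \<sigma>)})
    / real (card (perm_profiles n k))"
  unfolding distance_def prob_profile_eq by simp

section \<open>Manipulation by neighbour swaps\<close>

definition swap_manipulations ::
  "nat \<Rightarrow> nat \<Rightarrow> ((nat \<Rightarrow> nat \<Rightarrow> nat) \<Rightarrow> nat) \<Rightarrow> (nat \<Rightarrow> nat \<Rightarrow> nat) set" where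
  "swap_manipulations n k F = {\<sigma> \<in> perm_profiles n k. \<exists>i\<in>{1..n}. \<exists>j\<in>{1..<k}.
     \<sigma> i (F (\<sigma>(i := adj_swap j \<circ> \<sigma> i))) < \<sigma> i (F \<sigma>)}"

text \<open>Without manipulation at either end, the old ranking does not prefer the new outcome and
  the new ranking does not prefer the old one. So the two rankings order distinct outcomes
  oppositely, and a neighbour swap reverses only the pair at positions \<open>j\<close> and
  \<open>Suc j\<close>.\<close>

lemma tame_swap_manipulations:
  assumes F: "F ` perm_profiles n k \<subseteq> {1..k}"
    and N: "swap_manipulations n k F \<subseteq> N" "N \<subseteq> perm_profiles n k"
  shows "tame n k F N"
  unfolding tame_def
proof (intro conjI ballI impI F N(2))
  fix \<sigma> i j
  assume \<sigma>: "\<sigma> \<in> perm_profiles n k" and i: "i \<in> {1..n}" and j: "j \<in> {1..<k}"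
    and nN: "\<sigma> \<notin> N" "\<sigma>(i := adj_swap j \<circ> \<sigma> i) \<notin> N"
    and ne: "F \<sigma> \<noteq> F (\<sigma>(i := adj_swap j \<circ> \<sigma> i))"
  let ?\<tau> = "\<sigma>(i := adj_swap j \<circ> \<sigma> i)"
  have p: "\<sigma> i \<in> perms k" by (rule perm_profiles_nth[OF \<sigma> i])
  have \<tau>: "?\<tau> \<in> perm_profiles n k" using j by (intro perm_profiles_upd \<sigma> i perms_adj_swap p) auto
  have twice: "?\<tau>(i := adj_swap j \<circ> ?\<tau> i) = \<sigma>" by (simp add: comp_assoc[symmetric])
  have 1: "\<not> \<sigma> i (F ?\<tau>) < \<sigma> i (F \<sigma>)"
    using nN(1) N(1) \<sigma> i j unfolding swap_manipulations_def by blast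
  have "\<not> ?\<tau> i (F (?\<tau>(i := adj_swap j \<circ> ?\<tau> i))) < ?\<tau> i (F ?\<tau>)"
    using nN(2) N(1) \<tau> i j unfolding swap_manipulations_def by blast
  then have 2: "\<not> adj_swap j (\<sigma> i (F \<sigma>)) < adj_swap j (\<sigma> i (F ?\<tau>))"
    unfolding twice by simp
  have 3: "\<sigma> i (F \<sigma>) \<noteq> \<sigma> i (F ?\<tau>)" using perms_inj[OF p] ne by simp
  have "x = j \<and> y = Suc j"
    if "\<not> y < x" "\<not> adj_swap j x < adj_swap j y" "x \<noteq> y" for x y :: nat
    using that by (auto simp: Transposition.transpose_def split: if_splits)
  from this[OF 1 2 3] show "\<sigma> i (F \<sigma>) = j" "\<sigma> i (F ?\<tau>) = Suc j" by auto
qed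

lemma swap_manipulations_le:
  assumes f: "f \<in> SCF n k"
  shows "real (card (swap_manipulations n k (\<lambda>\<sigma>. f (profile_of n k \<sigma>)))) / real (card (perm_profiles n k))
    \<le> prob_profile n k (r_manipulation_points 3 n k f)"
proof -
  let ?F = "\<lambda>\<sigma>. f (profile_of n k \<sigma>)"
  have "profile_of n k \<sigma> \<in> r_manipulation_points 3 n k f" if s: "\<sigma> \<in> swap_manipulations n k ?F" for \<sigma>
  proof -
    obtain i j where i: "i \<in> {1..n}" and j: "j \<in> {1..<k}" and \<sigma>: "\<sigma> \<in> perm_profiles n k"
      and m: "\<sigma> i (?F (\<sigma>(i := adj_swap j \<circ> \<sigma> i))) < \<sigma> i (?F \<sigma>)"
      using s unfolding swap_manipulations_def by blast
    let ?\<tau> = "\<sigma>(i := adj_swap j \<circ> \<sigma> i)"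
    have p: "\<sigma> i \<in> perms k" by (rule perm_profiles_nth[OF \<sigma> i])
    have \<tau>: "?\<tau> \<in> perm_profiles n k" using j by (intro perm_profiles_upd \<sigma> i perms_adj_swap p) auto
    have F: "?F \<sigma> \<in> {1..k}" "?F ?\<tau> \<in> {1..k}"
      using f profile_of_in[OF \<sigma>] profile_of_in[OF \<tau>] unfolding SCF_def by (auto simp del: atLeastAtMost_iff)
    have "differ_only_at n i (profile_of n k \<sigma>) (profile_of n k ?\<tau>)"
      unfolding differ_only_at_def profile_of_def by auto
    moreover have "prefers (profile_of n k \<sigma> i) (?F ?\<tau>) (?F \<sigma>)"
      unfolding profile_of_nth[OF i] prefers_rank_of[OF p F(2,1)] by (rule m)
    moreover have "adjacent_permutation k 3 (profile_of n k \<sigma> i) (profile_of n k ?\<tau> i)"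
      unfolding profile_of_nth[OF i] using adjacent_permutation_adj_swap[OF p, of j] j by simp
    ultimately show ?thesis
      unfolding r_manipulation_points_def using i profile_of_in[OF \<sigma>] profile_of_in[OF \<tau>] by blast
  qed
  then have "swap_manipulations n k ?F
      \<subseteq> {\<sigma> \<in> perm_profiles n k. profile_of n k \<sigma> \<in> r_manipulation_points 3 n k f}"
    unfolding swap_manipulations_def by blast
  then show ?thesis unfolding prob_profile_eq
    by (intro divide_right_mono of_nat_mono card_mono) auto
qed

section \<open>Members of \<open>NONMANIP\<close> and minimal distances\<close>

lemma top_in_NONMANIP:
  assumes "i \<in> {1..n}" "H \<noteq> {}" "H \<subseteq> {1..k}"
  shows "(\<lambda>\<pi>\<in>profiles n k. top_of H (\<pi> i)) \<in> NONMANIP n k"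
proof -
  have "top_of H (\<pi> i) \<in> {1..k}" if "\<pi> \<in> profiles n k" for \<pi>
    using top_of_in[OF _ assms(2,3), of "\<pi> i"] that assms(1,3) unfolding profiles_def
    by (meson PiE_mem subsetD)
  then have "(\<lambda>\<pi>\<in>profiles n k. top_of H (\<pi> i)) \<in> SCF n k"
    unfolding SCF_def by (intro restrict_PiE_iff[THEN iffD2] ballI)
  then show ?thesis unfolding NONMANIP_def using assms
    by (intro CollectI conjI disjI1 bexI[of _ i] exI[of _ H]) simp_all
qed

lemma finite_SCF: "finite (SCF n k)"
  unfolding SCF_def using finite_profiles by (intro finite_PiE) simp_all

lemma distance_to_set_le:
  assumes "G \<subseteq> SCF n k" "g \<in> G"
  shows "distance_to_set n k f G \<le> distance n k f g"
  unfolding distance_to_set_def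
  using assms finite_subset[OF assms(1) finite_SCF] by (intro Min_le) auto

lemma distance_to_set_attained:
  assumes "G \<subseteq> SCF n k" "G \<noteq> {}"
  obtains g where "g \<in> G" "distance_to_set n k f G = distance n k f g"
proof -
  have "distance_to_set n k f G \<in> distance n k f ` G"
    unfolding distance_to_set_def
    using assms finite_subset[OF assms(1) finite_SCF] by (intro Min_in) auto
  then show ?thesis using that by auto
qed

subsection \<open>Distance to the nonmanipulable functions\<close>

text \<open>If changing voter \<open>i\<close> alone changes the value, then by \<open>det\<close>
  that voter's comparison of \<open>a\<close> and \<open>b\<close> has changed, and
  \<open>mono\<close> fixes the direction. Constant \<open>G\<close> is treated apart, as
  \<open>monotone_two_valued\<close> asks for exactly two values.\<close>

lemma (in near_two_valued) monotone_in_NONMANIP: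
  assumes n: "n \<ge> 1"
    and det: "\<And>\<sigma> \<tau>. \<sigma> \<in> Q \<Longrightarrow> \<tau> \<in> Q \<Longrightarrow>
      (\<forall>i\<in>{1..n}. (\<sigma> i a < \<sigma> i b) = (\<tau> i a < \<tau> i b)) \<Longrightarrow> G \<sigma> = G \<tau>"
    and mono: "\<And>i \<sigma>. i \<in> {1..n} \<Longrightarrow> \<sigma> \<in> Q \<Longrightarrow> \<not> \<sigma> i a < \<sigma> i b \<Longrightarrow> G \<sigma> \<Longrightarrow> G (flip i \<sigma>)"
  shows "\<exists>g\<in>NONMANIP n k. \<forall>\<sigma>\<in>Q. g (profile_of n k \<sigma>) = (if G \<sigma> then a else b)"
proof -
  define g where "g = (\<lambda>\<pi>\<in>profiles n k. if G (inv_into Q (profile_of n k) \<pi>) then a else b)"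
  have g: "g (profile_of n k \<sigma>) = (if G \<sigma> then a else b)" if "\<sigma> \<in> Q" for \<sigma>
    using bij_betw_inv_into_left[OF bij_profile_of that] profile_of_in[OF that] unfolding g_def by simp
  have scf: "g \<in> SCF n k"
    unfolding g_def SCF_def using a b by (intro restrict_PiE_iff[THEN iffD2] ballI) (simp split: if_split)
  \<comment> \<open>A constant function is the top of a singleton for voter 1, who exists by
    \<open>n \<ge> 1\<close>.\<close>
  have const: "\<exists>g'\<in>NONMANIP n k. \<forall>\<sigma>\<in>Q. g' (profile_of n k \<sigma>) = (if G \<sigma> then a else b)"
    if c: "c \<in> {1..k}" "\<And>\<sigma>. \<sigma> \<in> Q \<Longrightarrow> (if G \<sigma> then a else b) = c" for c
  proof (intro bexI ballI)
    have n1: "1 \<in> {1..n}" using n by simp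
    show "(\<lambda>\<pi>\<in>profiles n k. top_of {c} (\<pi> 1)) \<in> NONMANIP n k"
      using c n1 by (intro top_in_NONMANIP) auto
    fix \<sigma> assume \<sigma>: "\<sigma> \<in> Q"
    have "top_of {c} (rank_of k (\<sigma> 1)) = c"
      using c(1) by (intro top_of_rank_of[OF perm_profiles_nth[OF \<sigma> n1]]) auto
    then show "(\<lambda>\<pi>\<in>profiles n k. top_of {c} (\<pi> 1)) (profile_of n k \<sigma>) = (if G \<sigma> then a else b)"
      using c(2)[OF \<sigma>] profile_of_in[OF \<sigma>] profile_of_nth[OF n1] by simp
  qed
  show ?thesis
  proof (cases "(\<exists>\<sigma>\<in>Q. G \<sigma>) \<and> (\<exists>\<sigma>\<in>Q. \<not> G \<sigma>)")
    case False
    then consider "\<And>\<sigma>. \<sigma> \<in> Q \<Longrightarrow> G \<sigma>" | "\<And>\<sigma>. \<sigma> \<in> Q \<Longrightarrow> \<not> G \<sigma>" by blast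
    then show ?thesis using const[OF a] const[OF b] by cases simp_all
  next
    case True
    have "g ` profiles n k = (\<lambda>\<sigma>. if G \<sigma> then a else b) ` Q"
      unfolding profiles_eq[symmetric] image_image using g by (rule image_cong[OF refl])
    also have "\<dots> = {a, b}" using True by auto
    finally have im: "g ` profiles n k = {a, b}" .
    have "prefers (profile_of n k \<sigma> i) a b \<and> prefers (profile_of n k \<tau> i) b a"
      if i: "i \<in> {1..n}" and \<sigma>: "\<sigma> \<in> Q" and \<tau>: "\<tau> \<in> Q"
        and d: "differ_only_at n i (profile_of n k \<sigma>) (profile_of n k \<tau>)"
        and ga: "g (profile_of n k \<sigma>) = a" and gb: "g (profile_of n k \<tau>) = b" for i \<sigma> \<tau>
    proof -
      have G: "G \<sigma>" "\<not> G \<tau>" using ga gb g[OF \<sigma>] g[OF \<tau>] ab by (auto split: if_splits)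
      have same: "\<tau> j = \<sigma> j" if "j \<in> {1..n}" "j \<noteq> i" for j
      proof -
        have "rank_of k (\<tau> j) = rank_of k (\<sigma> j)"
          using d that unfolding differ_only_at_def by (simp add: profile_of_nth)
        then show ?thesis
          by (rule inj_onD[OF inj_on_rank_of])
            (rule perm_profiles_nth[OF \<sigma> that(1)] perm_profiles_nth[OF \<tau> that(1)])+
      qed
      have ne: "(\<sigma> i a < \<sigma> i b) \<noteq> (\<tau> i a < \<tau> i b)"
      proof
        assume "(\<sigma> i a < \<sigma> i b) = (\<tau> i a < \<tau> i b)"
        then have "\<forall>j\<in>{1..n}. (\<sigma> j a < \<sigma> j b) = (\<tau> j a < \<tau> j b)" using same by metis
        then show False using det[OF \<sigma> \<tau>] G by blast
      qed
      \<comment> \<open>Otherwise flipping voter \<open>i\<close> in \<open>\<sigma>\<close> would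
        give the comparisons of \<open>\<tau>\<close>, and monotonicity would make
        \<open>G \<tau>\<close> hold.\<close>
      have up: "\<sigma> i a < \<sigma> i b"
      proof (rule ccontr)
        assume n: "\<not> \<sigma> i a < \<sigma> i b"
        have "(flip i \<sigma> j a < flip i \<sigma> j b) = (\<tau> j a < \<tau> j b)" if "j \<in> {1..n}" for j
          using ne n same[OF that] swap_order[OF perm_profiles_nth[OF \<sigma> i] ab]
          unfolding flip_def by (cases "j = i") auto
        then have "G (flip i \<sigma>) = G \<tau>" by (intro det flip_in \<sigma> \<tau> i) blast
        then show False using mono[OF i \<sigma> n G(1)] G(2) by blast
      qed
      moreover have "\<tau> i b < \<tau> i a"
        using up ne perms_inj[OF perm_profiles_nth[OF \<tau> i], of a b] ab by auto
      ultimately show ?thesis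
        unfolding profile_of_nth[OF i]
        by (simp add: prefers_rank_of[OF perm_profiles_nth[OF \<sigma> i] a b]
            prefers_rank_of[OF perm_profiles_nth[OF \<tau> i] b a])
    qed
    then have "\<forall>i\<in>{1..n}. \<forall>\<sigma>\<in>profiles n k. \<forall>\<sigma>'\<in>profiles n k.
        differ_only_at n i \<sigma> \<sigma>' \<longrightarrow> g \<sigma> = a \<longrightarrow> g \<sigma>' = b \<longrightarrow> prefers (\<sigma> i) a b \<and> prefers (\<sigma>' i) b a"
      unfolding profiles_eq[symmetric] ball_simps by simp
    then have "monotone_two_valued n k g" unfolding monotone_two_valued_def using im ab by blast
    then have "g \<in> NONMANIP n k" using scf unfolding NONMANIP_def by simp
    then show ?thesis using g by blast
  qed
qed

lemma SCF_profile_of_range: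
  assumes "f \<in> SCF n k"
  shows "(\<lambda>\<sigma>. f (profile_of n k \<sigma>)) ` perm_profiles n k \<subseteq> {1..k}"
  by (intro image_subsetI PiE_mem[OF assms[unfolded SCF_def]] profile_of_in)

lemma distance_le_1: "distance n k f g \<le> 1"
  unfolding distance_def prob_profile_def by simp

text \<open>The error set joins manipulations and disagreements with \<open>g\<close>, each of
  density at most \<open>\<alpha>\<close>; hence 82 is \<open>2 * 41\<close>.\<close>

lemma two_valued_near_NONMANIP:
  assumes n: "n \<ge> 1" and k: "k \<ge> 2" and f: "f \<in> SCF n k" and g: "g \<in> SCF n k"
    and two: "card (g ` profiles n k) \<le> 2" and d: "distance n k f g \<le> \<alpha>"
    and m: "real (card (swap_manipulations n k (\<lambda>\<sigma>. f (profile_of n k \<sigma>))))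
      / real (card (perm_profiles n k)) \<le> \<alpha>"
  shows "\<exists>g'\<in>NONMANIP n k. distance n k f g' \<le> 82 * real n ^ 2 * real k ^ 4 * \<alpha>"
proof -
  let ?Q = "perm_profiles n k" and ?F = "\<lambda>\<sigma>. f (profile_of n k \<sigma>)"
  have q: "card ?Q > 0" using perm_profiles_nonempty by (simp add: card_gt_0_iff)
  obtain \<pi> where \<pi>: "\<pi> \<in> profiles n k" using perm_profiles_nonempty profile_of_in by blast
  have sub: "g ` profiles n k \<subseteq> {1..k}" by (intro image_subsetI PiE_mem[OF g[unfolded SCF_def]])
  \<comment> \<open>If \<open>g\<close> is constant, any other alternative serves as the second
    value, available as \<open>k \<ge> 2\<close>.\<close>
  obtain a b where vals: "a \<in> {1..k}" "b \<in> {1..k}" "a \<noteq> b" "g ` profiles n k \<subseteq> {a, b}"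
  proof (cases "card (g ` profiles n k) = 2")
    case True
    then obtain a b where "g ` profiles n k = {a, b}" "a \<noteq> b" by (auto simp: card_2_iff)
    then show ?thesis using that[of a b] sub by auto
  next
    case False
    have "card (g ` profiles n k) > 0" using \<pi> finite_profiles by (auto simp: card_gt_0_iff)
    then have "card (g ` profiles n k) = 1" using two False by linarith
    then obtain a where a: "g ` profiles n k = {a}" by (rule card_1_singletonE)
    define b where "b = (if a = 1 then 2 else 1 :: nat)"
    have "b \<in> {1..k}" "a \<noteq> b" using k unfolding b_def by auto
    then show ?thesis using that[of a b] a sub by auto
  qed
  let ?M = "swap_manipulations n k ?F" and ?B = "{\<sigma> \<in> ?Q. ?F \<sigma> \<noteq> g (profile_of n k \<sigma>)}"
  let ?N = "?M \<union> ?B"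
  interpret near_two_valued n k ?F ?N a b
  proof
    show "tame n k ?F ?N"
      using SCF_profile_of_range[OF f] by (rule tame_swap_manipulations) (auto simp: swap_manipulations_def)
    fix \<sigma> assume "\<sigma> \<in> ?Q" "\<sigma> \<notin> ?N"
    then show "?F \<sigma> = a \<or> ?F \<sigma> = b" using vals(4) profile_of_in[of \<sigma> n k] by auto
  qed (use vals in auto)
  obtain G where G: "\<And>\<sigma> \<tau>. \<sigma> \<in> ?Q \<Longrightarrow> \<tau> \<in> ?Q \<Longrightarrow>
      (\<forall>i\<in>{1..n}. (\<sigma> i a < \<sigma> i b) = (\<tau> i a < \<tau> i b)) \<Longrightarrow> G \<sigma> = G \<tau>"
    "\<And>i \<sigma>. i \<in> {1..n} \<Longrightarrow> \<sigma> \<in> ?Q \<Longrightarrow> \<not> \<sigma> i a < \<sigma> i b \<Longrightarrow> G \<sigma> \<Longrightarrow> G (flip i \<sigma>)"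
    and cG: "card {\<sigma> \<in> ?Q. (?F \<sigma> = a) \<noteq> G \<sigma>} \<le> 40 * n\<^sup>2 * k ^ 4 * card ?N"
    by (rule near_monotone) blast
  obtain g' where g': "g' \<in> NONMANIP n k"
    "\<And>\<sigma>. \<sigma> \<in> ?Q \<Longrightarrow> g' (profile_of n k \<sigma>) = (if G \<sigma> then a else b)"
    using monotone_in_NONMANIP[where G = G, OF n G] by blast
  let ?E = "{\<sigma> \<in> ?Q. ?F \<sigma> \<noteq> g' (profile_of n k \<sigma>)}"
  have "?E \<subseteq> ?N \<union> {\<sigma> \<in> ?Q. (?F \<sigma> = a) \<noteq> G \<sigma>}"
  proof
    fix \<sigma> assume "\<sigma> \<in> ?E"
    then show "\<sigma> \<in> ?N \<union> {\<sigma> \<in> ?Q. (?F \<sigma> = a) \<noteq> G \<sigma>}"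
      using g'(2)[of \<sigma>] two_values[of \<sigma>] by auto
  qed
  then have "card ?E \<le> card (?N \<union> {\<sigma> \<in> ?Q. (?F \<sigma> = a) \<noteq> G \<sigma>})"
    using finite_N by (intro card_mono) auto
  also have "\<dots> \<le> card ?N + 40 * n\<^sup>2 * k ^ 4 * card ?N"
    by (intro order_trans[OF card_Un_le] add_left_mono cG)
  \<comment> \<open>40 comes from \<open>near_monotone\<close>, and one more pays for
    \<open>?N\<close> itself, where the outcome may be neither value.\<close>
  also have "\<dots> \<le> 41 * n\<^sup>2 * k ^ 4 * card ?N"
  proof -
    have "1 \<le> n\<^sup>2 * k ^ 4" using n k by (simp add: Suc_le_eq)
    from mult_right_mono[OF this, of "card ?N"] show ?thesis by simp
  qed
  finally have cE: "real (card ?E) \<le> 41 * real n ^ 2 * real k ^ 4 * real (card ?N)"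
    by (metis (no_types, lifting) of_nat_le_iff of_nat_mult of_nat_numeral of_nat_power)
  have "real (card ?M) \<le> \<alpha> * real (card ?Q)" "real (card ?B) \<le> \<alpha> * real (card ?Q)"
    using m d q unfolding distance_eq by (simp_all add: field_simps)
  then have "real (card ?N) \<le> 2 * \<alpha> * real (card ?Q)"
    using card_Un_le[of ?M ?B] by linarith
  from mult_left_mono[OF this, of "41 * real n ^ 2 * real k ^ 4"] cE
  have "real (card ?E) \<le> 82 * real n ^ 2 * real k ^ 4 * \<alpha> * real (card ?Q)" by (simp add: mult_ac)
  then have "distance n k f g' \<le> 82 * real n ^ 2 * real k ^ 4 * \<alpha>"
    unfolding distance_eq using q by (simp add: field_simps)
  then show ?thesis using g'(1) by blast
qed

lemma one_voter_near_NONMANIP: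
  assumes k: "k \<ge> 1" and i: "i \<in> {1..n}" and f: "f \<in> SCF n k"
    and dep: "\<And>\<sigma> \<tau>. \<sigma> \<in> profiles n k \<Longrightarrow> \<tau> \<in> profiles n k \<Longrightarrow> \<sigma> i = \<tau> i \<Longrightarrow> g \<sigma> = g \<tau>"
    and d: "distance n k f g \<le> \<alpha>"
    and m: "real (card (swap_manipulations n k (\<lambda>\<sigma>. f (profile_of n k \<sigma>))))
      / real (card (perm_profiles n k)) \<le> \<alpha>"
  shows "\<exists>g'\<in>NONMANIP n k. distance n k f g' \<le> 21 * real k ^ 4 * \<alpha>"
proof -
  let ?Q = "perm_profiles n k" and ?F = "\<lambda>\<sigma>. f (profile_of n k \<sigma>)"
  let ?M = "swap_manipulations n k ?F" and ?B = "{\<sigma> \<in> ?Q. ?F \<sigma> \<noteq> g (profile_of n k \<sigma>)}"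
  have q: "card ?Q > 0" using perm_profiles_nonempty by (simp add: card_gt_0_iff)
  have k4: "1 \<le> real k ^ 4" using k by simp
  have MB: "real (card ?M) \<le> \<alpha> * real (card ?Q)" "real (card ?B) \<le> \<alpha> * real (card ?Q)"
    using m d q unfolding distance_eq by (simp_all add: field_simps)
  have MB4: "10 * real k ^ 4 * real (card ?M + card ?B) \<le> 20 * real k ^ 4 * \<alpha> * real (card ?Q)"
    using mult_left_mono[of "real (card ?M + card ?B)" "2 * \<alpha> * real (card ?Q)" "10 * real k ^ 4"] MB
    by (simp add: algebra_simps)
  have \<alpha>: "0 \<le> \<alpha>" using order_trans[OF _ m] by simp
  show ?thesis
  proof (cases "10 * k ^ 4 * (card ?M + card ?B) < card ?Q")
    case False
    \<comment> \<open>The claimed bound is then at least 1, so any member of \<open>NONMANIP\<close>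
      will do.\<close>
    have "real (card ?Q) \<le> real (10 * k ^ 4 * (card ?M + card ?B))"
      using False by (simp only: of_nat_le_iff not_less)
    also have "\<dots> = 10 * real k ^ 4 * real (card ?M + card ?B)" by simp
    finally have "1 * real (card ?Q) \<le> 20 * real k ^ 4 * \<alpha> * real (card ?Q)"
      using MB4 by linarith
    then have "1 \<le> 20 * real k ^ 4 * \<alpha>" using q by (simp only: mult_le_cancel_right of_nat_0_less_iff)
    also have "\<dots> \<le> 21 * real k ^ 4 * \<alpha>" using \<alpha> by (intro mult_right_mono) auto
    finally have "1 \<le> 21 * real k ^ 4 * \<alpha>" .
    moreover have "(\<lambda>\<pi>\<in>profiles n k. top_of {1} (\<pi> i)) \<in> NONMANIP n k"
      using k by (intro top_in_NONMANIP i) auto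
    ultimately show ?thesis using order_trans[OF distance_le_1] by blast
  next
    case True
    \<comment> \<open>\<open>g\<close> is read off at the profile where all voters share the ranking
      \<open>p\<close>, which is legitimate because \<open>g\<close> sees voter \<open>i\<close>
      alone.\<close>
    define h where "h p = g (profile_of n k (\<lambda>j\<in>{1..n}. p))" for p
    have h: "h (\<sigma> i) = g (profile_of n k \<sigma>)" if \<sigma>: "\<sigma> \<in> ?Q" for \<sigma>
    proof -
      have "(\<lambda>j\<in>{1..n}. \<sigma> i) \<in> ?Q"
        unfolding perm_profiles_def restrict_PiE_iff using perm_profiles_nth[OF \<sigma> i] by simp
      then show ?thesis
        unfolding h_def using i by (intro dep profile_of_in \<sigma>) (simp_all add: profile_of_nth)
    qed
    have B: "?B = {\<sigma> \<in> ?Q. ?F \<sigma> \<noteq> h (\<sigma> i)}" using h by auto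
    have tame: "tame n k ?F ?M"
      using SCF_profile_of_range[OF f] by (rule tame_swap_manipulations) (auto simp: swap_manipulations_def)
    obtain H where H: "H \<noteq> {}" "H \<subseteq> {1..k}"
      and cH: "card {\<sigma> \<in> ?Q. \<not> (?F \<sigma> \<in> H \<and> (\<forall>b\<in>H. \<sigma> i (?F \<sigma>) \<le> \<sigma> i b))}
        \<le> card ?B + 10 * k ^ 4 * (card ?M + card ?B)"
      by (rule near_one_voter_near_top[OF tame i k B True])
    let ?g = "\<lambda>\<pi>\<in>profiles n k. top_of H (\<pi> i)"
    let ?E = "{\<sigma> \<in> ?Q. ?F \<sigma> \<noteq> ?g (profile_of n k \<sigma>)}"
    have "?E \<subseteq> {\<sigma> \<in> ?Q. \<not> (?F \<sigma> \<in> H \<and> (\<forall>b\<in>H. \<sigma> i (?F \<sigma>) \<le> \<sigma> i b))}"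
    proof (rule subsetI, rule ccontr)
      fix \<sigma> assume \<sigma>: "\<sigma> \<in> ?E" and n: "\<sigma> \<notin> {\<sigma> \<in> ?Q. \<not> (?F \<sigma> \<in> H \<and> (\<forall>b\<in>H. \<sigma> i (?F \<sigma>) \<le> \<sigma> i b))}"
      then have Q: "\<sigma> \<in> ?Q" by simp
      have "top_of H (rank_of k (\<sigma> i)) = ?F \<sigma>"
        using n Q by (intro top_of_rank_of[OF perm_profiles_nth[OF Q i] H(2)]) auto
      then show False using \<sigma> profile_of_in[OF Q] by (simp add: profile_of_nth[OF i])
    qed
    then have "card ?E \<le> card ?B + 10 * k ^ 4 * (card ?M + card ?B)"
      using card_mono[of "{\<sigma> \<in> ?Q. \<not> (?F \<sigma> \<in> H \<and> (\<forall>b\<in>H. \<sigma> i (?F \<sigma>) \<le> \<sigma> i b))}" ?E] cH by simp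
    then have "real (card ?E) \<le> real (card ?B + 10 * k ^ 4 * (card ?M + card ?B))"
      by (simp only: of_nat_le_iff)
    also have "\<dots> = real (card ?B) + 10 * real k ^ 4 * real (card ?M + card ?B)" by simp
    also have "\<dots> \<le> \<alpha> * real (card ?Q) + 20 * real k ^ 4 * \<alpha> * real (card ?Q)"
      by (rule add_mono[OF MB(2) MB4])
    \<comment> \<open>21 is \<open>1 + 20\<close>, the 1 being the disagreement with
      \<open>g\<close>.\<close>
    also have "\<dots> \<le> 21 * real k ^ 4 * \<alpha> * real (card ?Q)"
      using mult_right_mono[OF k4, of "\<alpha> * real (card ?Q)"] \<alpha> by (simp add: mult_ac)
    finally have "distance n k f ?g \<le> 21 * real k ^ 4 * \<alpha>"
      unfolding distance_eq using q by (simp add: field_simps)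
    then show ?thesis using top_in_NONMANIP[OF i H] by blast
  qed
qed

text \<open>For \<alpha> \<le> 1 the linear bound is at most the cube-root one, strictly as 82 <
  100; for \<alpha> > 1 the right side exceeds 1.\<close>

lemma bound_less:
  assumes n: "n \<ge> 1" and k: "k \<ge> 1" and \<alpha>: "0 < \<alpha>" and d: "d \<le> 1"
    "d \<le> 82 * real n ^ 2 * real k ^ 4 * \<alpha>"
  shows "d < 100 * real n ^ 4 * real k ^ 8 * \<alpha> powr (1/3)"
proof -
  have nk: "1 \<le> real n ^ 4 * real k ^ 8"
    using n k mult_mono[of 1 "real n ^ 4" 1 "real k ^ 8"] by simp
  show ?thesis
  proof (cases "\<alpha> \<le> 1")
    case True
    have "\<alpha> = \<alpha> powr 1" using \<alpha> by simp
    also have "\<dots> \<le> \<alpha> powr (1/3)" using \<alpha> True by (intro powr_mono') auto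
    finally have p: "\<alpha> \<le> \<alpha> powr (1/3)" .
    have "d \<le> 82 * (real n ^ 2 * real k ^ 4) * \<alpha>" using d(2) by (simp add: mult.assoc)
    also have "\<dots> \<le> 82 * (real n ^ 4 * real k ^ 8) * \<alpha> powr (1/3)"
      using n k \<alpha> p by (intro mult_mono power_increasing) auto
    also have "\<dots> < 100 * (real n ^ 4 * real k ^ 8) * \<alpha> powr (1/3)"
      using nk \<alpha> by (intro mult_strict_right_mono) auto
    finally show ?thesis by (simp add: mult.assoc)
  next
    case False
    then have "1 \<le> \<alpha> powr (1/3)" by (intro ge_one_powr_ge_zero) auto
    then have "1 * 1 \<le> (real n ^ 4 * real k ^ 8) * \<alpha> powr (1/3)" using nk by (intro mult_mono) auto
    then show ?thesis using d(1) by (simp add: mult.assoc)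
  qed
qed

theorem theorem1p5:
  fixes n k :: nat and \<alpha> :: real and f :: "(nat \<Rightarrow> nat rel) \<Rightarrow> nat"
  assumes "n \<ge> 1" and "k \<ge> 3" and "\<alpha> \<ge> 0"
    and "f \<in> SCF n k"
    and "distance_to_set n k f (NONMANIP_bar n k) \<le> \<alpha>"
  shows "distance_to_set n k f (NONMANIP n k) < 100 * real n ^ 4 * real k ^ 8 * \<alpha> powr (1/3) \<or>
    (prob_profile n k (manipulation_points n k f) \<ge> prob_profile n k (r_manipulation_points 3 n k f) \<and>
     prob_profile n k (r_manipulation_points 3 n k f) \<ge> \<alpha>)"
proof -
  have k1: "1 \<le> k" using assms(2) by simp
  have sub: "NONMANIP n k \<subseteq> SCF n k" "NONMANIP_bar n k \<subseteq> SCF n k"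
    unfolding NONMANIP_def NONMANIP_bar_def by auto
  \<comment> \<open>A witness that the class is nonempty, so that the \<open>Min\<close> in
    \<open>distance_to_set\<close> is attained.\<close>
  have "(\<lambda>\<pi>\<in>profiles n k. top_of {1} (\<pi> 1)) \<in> NONMANIP n k"
    using assms(1,2) by (intro top_in_NONMANIP) auto
  then have "(\<lambda>\<pi>\<in>profiles n k. top_of {1} (\<pi> 1)) \<in> NONMANIP_bar n k"
    using assms(1) sub(1) unfolding NONMANIP_bar_def
    by (intro CollectI conjI disjI1 bexI[of _ 1] subsetD[OF sub(1)]) simp_all
  then have ne: "NONMANIP_bar n k \<noteq> {}" by (metis empty_iff)
  obtain g where g: "g \<in> NONMANIP_bar n k" "distance n k f g \<le> \<alpha>"
    by (rule distance_to_set_attained[OF sub(2) ne, of f]) (use assms(5) in simp)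
  have gS: "g \<in> SCF n k" by (rule subsetD[OF sub(2) g(1)])
  have le: "prob_profile n k (r_manipulation_points 3 n k f) \<le> prob_profile n k (manipulation_points n k f)"
    unfolding prob_profile_def
  proof (rule measure_pmf.finite_measure_mono)
    show "r_manipulation_points 3 n k f \<subseteq> manipulation_points n k f"
      unfolding r_manipulation_points_def manipulation_points_def 
      by (intro Collect_mono impI) (elim conjE bexE, intro conjI bexI)
  qed simp
  show ?thesis
  proof (cases "prob_profile n k (r_manipulation_points 3 n k f) \<ge> \<alpha>")
    case True
    then show ?thesis using le by simp
  next
    case False
    \<comment> \<open>Probabilities are nonnegative, so failure of the second alternative excludes
      \<open>\<alpha> = 0\<close>, where no strict bound could hold.\<close>
    have \<alpha>: "0 < \<alpha>"
    proof -
      have "0 \<le> prob_profile n k (r_manipulation_points 3 n k f)"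
        unfolding prob_profile_def by simp
      then show ?thesis using False by linarith
    qed
    have m: "real (card (swap_manipulations n k (\<lambda>\<sigma>. f (profile_of n k \<sigma>))))
      / real (card (perm_profiles n k)) \<le> \<alpha>"
      using swap_manipulations_le[OF assms(4)] False by linarith
    have "\<exists>g'\<in>NONMANIP n k. distance n k f g' \<le> 82 * real n ^ 2 * real k ^ 4 * \<alpha>"
    proof (cases "card (g ` profiles n k) \<le> 2")
      case True
      then show ?thesis using two_valued_near_NONMANIP[OF assms(1) _ assms(4) gS True g(2) m] assms(2) by simp
    next
      case False
      then have "\<exists>i\<in>{1..n}. \<forall>\<sigma>\<in>profiles n k. \<forall>\<sigma>'\<in>profiles n k. \<sigma> i = \<sigma>' i \<longrightarrow> g \<sigma> = g \<sigma>'"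
        using g(1) unfolding NONMANIP_bar_def by (simp only: mem_Collect_eq simp_thms)
      then obtain i where i: "i \<in> {1..n}"
        and dep: "\<forall>\<sigma>\<in>profiles n k. \<forall>\<sigma>'\<in>profiles n k. \<sigma> i = \<sigma>' i \<longrightarrow> g \<sigma> = g \<sigma>'"
        by (elim bexE)
      have "\<exists>g'\<in>NONMANIP n k. distance n k f g' \<le> 21 * real k ^ 4 * \<alpha>"
        by (rule one_voter_near_NONMANIP[OF k1 i assms(4) _ g(2) m]) (rule dep[rule_format])
      then obtain g' where g': "g' \<in> NONMANIP n k" "distance n k f g' \<le> 21 * real k ^ 4 * \<alpha>"
        by (elim bexE)
      have "21 * real k ^ 4 * \<alpha> \<le> 82 * real n ^ 2 * real k ^ 4 * \<alpha>"
      proof (intro mult_right_mono)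
        have "1 \<le> real n ^ 2" by (rule one_le_power) (use assms(1) in simp)
        then show "21 \<le> 82 * real n ^ 2" by linarith
      qed (use \<alpha> in simp_all)
      with g'(2) have "distance n k f g' \<le> 82 * real n ^ 2 * real k ^ 4 * \<alpha>" by linarith
      then show ?thesis using g'(1) by (rule bexI)
    qed
    then obtain g' where g': "g' \<in> NONMANIP n k" "distance n k f g' \<le> 82 * real n ^ 2 * real k ^ 4 * \<alpha>"
      by (elim bexE)
    have "distance_to_set n k f (NONMANIP n k) \<le> distance n k f g'"
      by (rule distance_to_set_le[OF sub(1) g'(1)])
    then have "distance_to_set n k f (NONMANIP n k) < 100 * real n ^ 4 * real k ^ 8 * \<alpha> powr (1/3)"
      using g'(2) distance_le_1[of n k f g'] assms(2)
      by (intro bound_less[OF assms(1) _ \<alpha>]) auto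
    then show ?thesis by simp
  qed
qed

end
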